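(* Let $E$ and $F$ be two Banach spaces and $T:F\to E$ a bounded linear operator, and let $\overline{T}:\operatorname{FBL}^{(\infty)}[F]\to\operatorname{FBL}^{(\infty)}[E]$ be the associated lattice homomorphism. (1) If $T$ is injective with closed range, then $\overline{T}:\operatorname{FBL}^{(\infty)}[F]\to\operatorname{FBL}^{(\infty)}[E]$ is order continuous. (2) If $\overline{T}$ is order continuous, then $T$ is injective.
   Context: Banach spaces are real. For a Banach space $E$ with dual $E^{*}$, $H[E]$ denotes the vector lattice (pointwise operations and order) of all positively homogeneous functions $f:E^{*}\to\mathbb{R}$, i.e. $f(\lambda x^{*})=\lambda f(x^{*})$ for all $\lambda\ge 0$, $x^{*}\in E^{*}$. For $x\in E$ let $\delta_E(x)=\delta_x\in H[E]$ be $\delta_x(x^{*})=x^{*}(x)$. Put $\|f\|_{\operatorname{FBL}^{(\infty)}[E]}=\sup_{x^{*}\in B_{E^{*}}}|f(x^{*})|$ and $H^{\infty}[E]=\{f\in H[E]:\|f\|_{\operatorname{FBL}^{(\infty)}[E]}<\infty\}$, a Banach lattice. The free $\infty$-convex Banach lattice $\operatorname{FBL}^{(\infty)}[E]$ is the norm-closed sublattice of $H^{\infty}[E]$ generated by $\delta_E(E)$; equivalently, it is the set of all $f\in H[E]$ that are weak* continuous on the closed unit ball $B_{E^{*}}$. For a bounded linear operator $T:F\to E$, $\overline{T}:\operatorname{FBL}^{(\infty)}[F]\to\operatorname{FBL}^{(\infty)}[E]$ is the unique (bounded) lattice homomorphism with $\overline{T}\circ\delta_F=\delta_E\circ T$;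 it is given by $\overline{T}f=f\circ T^{*}$, where $T^{*}:E^{*}\to F^{*}$ is the adjoint of $T$. A lattice homomorphism $S:X\to Y$ between vector lattices is order continuous if for every net $f_\alpha\downarrow 0$ in $X$ (decreasing with infimum $0$ in $X$) one has $Sf_\alpha\downarrow 0$ in $Y$.
   Formalization: In part (2) the operator T is additionally assumed to be nonzero: for T = 0 and F nontrivial, the associated lattice homomorphism is zero, hence order continuous, although T is not injective. *)

theory Defs
  imports "HOL-Analysis.Analysis"
begin

section \<open>Positively homogeneous functions on the dual\<close>

text \<open>The dual of \<open>'a\<close> is \<open>'a \<Rightarrow>\<^sub>L real\<close>. Vector lattices of real functions are subsets of
  \<open>'c \<Rightarrow> real\<close>; their linear and lattice operations and their order are pointwise.\<close>

definition pos_homogeneous :: "(('a::banach \<Rightarrow>\<^sub>L real) \<Rightarrow> real) set"  where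
  "pos_homogeneous = {f. \<forall>c\<ge>0. \<forall>\<phi>. f (c *\<^sub>R \<phi>) = c * f \<phi>}"

definition dual_eval :: "'a::banach \<Rightarrow> ('a \<Rightarrow>\<^sub>L real) \<Rightarrow> real"  where
  "dual_eval x = (\<lambda>\<phi>. blinfun_apply \<phi> x)"

text \<open>The supremum is meaningful only for functions bounded on the unit ball of the dual, as is the
  case on \<open>H_infty\<close>.\<close>

definition fbl_norm :: "(('a::banach \<Rightarrow>\<^sub>L real) \<Rightarrow> real) \<Rightarrow> real"  where
  "fbl_norm f = (SUP \<phi>\<in>cball 0 1. \<bar>f \<phi>\<bar>)"

definition H_infty :: "(('a::banach \<Rightarrow>\<^sub>L real) \<Rightarrow> real) set"  where
  "H_infty = {f \<in> pos_homogeneous. bdd_above ((\<lambda>\<phi>. \<bar>f \<phi>\<bar>) ` cball 0 1)}"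

definition function_sublattice :: "('c \<Rightarrow> real) set \<Rightarrow> bool"  where
  "function_sublattice X \<longleftrightarrow>
     (\<lambda>_. 0) \<in> X \<and>
     (\<forall>f\<in>X. \<forall>g\<in>X. (\<lambda>t. f t + g t) \<in> X) \<and>
     (\<forall>c. \<forall>f\<in>X. (\<lambda>t. c * f t) \<in> X) \<and>
     (\<forall>f\<in>X. \<forall>g\<in>X. sup f g \<in> X \<and> inf f g \<in> X)"

definition fbl_norm_closed :: "(('a::banach \<Rightarrow>\<^sub>L real) \<Rightarrow> real) set \<Rightarrow> bool"  where
  "fbl_norm_closed X \<longleftrightarrow>
     (\<forall>f\<in>H_infty. (\<forall>e>0. \<exists>g\<in>X. fbl_norm (\<lambda>\<phi>. f \<phi> - g \<phi>) < e) \<longrightarrow> f \<in> X)"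

definition FBL_infty :: "(('a::banach \<Rightarrow>\<^sub>L real) \<Rightarrow> real) set"  where
  "FBL_infty = \<Inter>{X. X \<subseteq> H_infty \<and> function_sublattice X \<and> fbl_norm_closed X \<and> range dual_eval \<subseteq> X}"


section \<open>Lattice homomorphisms and order continuity\<close>

definition lattice_hom_on ::
  "('c \<Rightarrow> real) set \<Rightarrow> ('d \<Rightarrow> real) set \<Rightarrow> (('c \<Rightarrow> real) \<Rightarrow> ('d \<Rightarrow> real)) \<Rightarrow> bool"  where
  "lattice_hom_on X Y S \<longleftrightarrow>
     S \<in> X \<rightarrow> Y \<and>
     (\<forall>f\<in>X. \<forall>g\<in>X. S (\<lambda>t. f t + g t) = (\<lambda>s. S f s + S g s)) \<and>
     (\<forall>c. \<forall>f\<in>X. S (\<lambda>t. c * f t) = (\<lambda>s. c * S f s)) \<and>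
     (\<forall>f\<in>X. \<forall>g\<in>X. S (sup f g) = sup (S f) (S g) \<and> S (inf f g) = inf (S f) (S g))"

definition directed_index :: "'i set \<Rightarrow> ('i \<Rightarrow> 'i \<Rightarrow> bool) \<Rightarrow> bool"  where
  "directed_index I le \<longleftrightarrow>
     I \<noteq> {} \<and> reflp_on I le \<and> transp_on I le \<and> (\<forall>i\<in>I. \<forall>j\<in>I. \<exists>k\<in>I. le i k \<and> le j k)"

text \<open>The infimum is taken in \<open>X\<close>; the pointwise infimum of the net may be different from 0.\<close>

definition decreases_to_zero ::
  "('c \<Rightarrow> real) set \<Rightarrow> 'i set \<Rightarrow> ('i \<Rightarrow> 'i \<Rightarrow> bool) \<Rightarrow> ('i \<Rightarrow> 'c \<Rightarrow> real) \<Rightarrow> bool"  where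
  "decreases_to_zero X I le f \<longleftrightarrow>
     f \<in> I \<rightarrow> X \<and> monotone_on I le (\<ge>) f \<and>
     (\<forall>i\<in>I. (\<lambda>_. 0) \<le> f i) \<and>
     (\<forall>g\<in>X. (\<forall>i\<in>I. g \<le> f i) \<longrightarrow> g \<le> (\<lambda>_. 0))"

text \<open>A definition cannot quantify over all index types. Nets indexed by subsets of the type of
  elements of \<open>X\<close> suffice: see \<open>order_continuous_on_net\<close> below.\<close>

definition order_continuous_on ::
  "('c \<Rightarrow> real) set \<Rightarrow> ('d \<Rightarrow> real) set \<Rightarrow> (('c \<Rightarrow> real) \<Rightarrow> ('d \<Rightarrow> real)) \<Rightarrow> bool"  where
  "order_continuous_on X Y S \<longleftrightarrow>
     (\<forall>(I :: ('c \<Rightarrow> real) set) le f.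
        directed_index I le \<longrightarrow> decreases_to_zero X I le f \<longrightarrow>
        decreases_to_zero Y I le (\<lambda>i. S (f i)))"

lemma order_continuous_on_net:
  fixes I :: "'i set"
  assumes S: "order_continuous_on X Y S"
    and I: "directed_index I le" and f: "decreases_to_zero X I le f"
  shows "decreases_to_zero Y I le (\<lambda>i. S (f i))"
proof -
  have "\<exists>k\<in>I. f k \<le> f i \<and> f k \<le> f j" if "i \<in> I" "j \<in> I" for i j
    using I f that unfolding directed_index_def decreases_to_zero_def monotone_on_def by meson
  then have "directed_index (f ` I) (\<ge>)"
    using I unfolding directed_index_def
    by (auto intro!: reflp_onI transp_onI intro: order_trans)
  moreover have "decreases_to_zero X (f ` I) (\<ge>) (\<lambda>x. x)"
    using f unfolding decreases_to_zero_def by (auto simp: monotone_on_def)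
  ultimately have "decreases_to_zero Y (f ` I) (\<ge>) (\<lambda>x. S x)"
    using S unfolding order_continuous_on_def by blast
  then show ?thesis
    using f unfolding decreases_to_zero_def by (simp add: Pi_iff monotone_on_def)
qed


section \<open>The induced homomorphism\<close>

definition adjoint_op ::
  "('b::banach \<Rightarrow>\<^sub>L 'a::banach) \<Rightarrow> ('a \<Rightarrow>\<^sub>L real) \<Rightarrow> ('b \<Rightarrow>\<^sub>L real)"  where
  "adjoint_op T \<phi> = \<phi> o\<^sub>L T"

definition free_hom ::
  "('b::banach \<Rightarrow>\<^sub>L 'a::banach) \<Rightarrow> (('b \<Rightarrow>\<^sub>L real) \<Rightarrow> real) \<Rightarrow> (('a \<Rightarrow>\<^sub>L real) \<Rightarrow> real)"  where
  "free_hom T f = f \<circ> adjoint_op T"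

text \<open>The rest of the theory shows that \<open>FBL_infty\<close> is itself a closed sublattice of \<open>H_infty\<close>, and
  that \<open>free_hom T\<close> is on \<open>FBL_infty\<close> the unique bounded lattice homomorphism extending \<open>T\<close>.\<close>

lemma sublatticeD:
  assumes "function_sublattice X"
  shows "(\<lambda>_. 0) \<in> X"
    and "\<And>f g. f \<in> X \<Longrightarrow> g \<in> X \<Longrightarrow> (\<lambda>t. f t + g t) \<in> X"
    and "\<And>c f. f \<in> X \<Longrightarrow> (\<lambda>t. c * f t) \<in> X"
    and "\<And>f g. f \<in> X \<Longrightarrow> g \<in> X \<Longrightarrow> sup f g \<in> X"
    and "\<And>f g. f \<in> X \<Longrightarrow> g \<in> X \<Longrightarrow> inf f g \<in> X"
  using assms unfolding function_sublattice_def by blast+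

lemma sublattice_diff:
  assumes X: "function_sublattice X" and f: "f \<in> X" and g: "g \<in> X"
  shows "(\<lambda>t. f t - g t) \<in> X"
proof -
  have add: "\<And>f g. f \<in> X \<Longrightarrow> g \<in> X \<Longrightarrow> (\<lambda>t. f t + g t) \<in> X"
    and neg: "(\<lambda>t. (- 1) * g t) \<in> X"
    using X g unfolding function_sublattice_def by blast+
  show ?thesis using add[OF f neg] by simp
qed

lemma H_infty_I:
  assumes "f \<in> pos_homogeneous" "\<And>\<phi>. norm \<phi> \<le> 1 \<Longrightarrow> \<bar>f \<phi>\<bar> \<le> C"
  shows "f \<in> H_infty"
  using assms unfolding H_infty_def by (auto intro!: bdd_aboveI[where M = C])

lemma abs_le_fbl_norm:
  assumes "f \<in> H_infty"
  shows "\<bar>f \<phi>\<bar> \<le> fbl_norm f * norm \<phi>"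
proof (cases "\<phi> = 0")
  case True
  have "f (0 *\<^sub>R 0) = 0 * f 0"
    using assms unfolding H_infty_def pos_homogeneous_def by blast
  then show ?thesis using True by simp
next
  case False
  let ?u = "(1 / norm \<phi>) *\<^sub>R \<phi>"
  have "\<bar>f ?u\<bar> \<le> fbl_norm f"
    unfolding fbl_norm_def using assms False
    by (intro cSUP_upper) (auto simp: H_infty_def)
  moreover have "f ?u = (1 / norm \<phi>) * f \<phi>"
    using assms unfolding H_infty_def pos_homogeneous_def by simp
  ultimately show ?thesis using False by (simp add: abs_mult field_simps)
qed

lemma fbl_norm_le:
  assumes "\<And>\<phi>. norm \<phi> \<le> 1 \<Longrightarrow> \<bar>f \<phi>\<bar> \<le> C"
  shows "fbl_norm f \<le> C"
  unfolding fbl_norm_def using assms by (intro cSUP_least) (auto intro: exI[of _ 0])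

lemma fbl_norm_nonneg:
  assumes "f \<in> H_infty"
  shows "0 \<le> fbl_norm f"
proof -
  have "\<bar>f 0\<bar> \<le> fbl_norm f"
    unfolding fbl_norm_def using assms by (intro cSUP_upper) (auto simp: H_infty_def)
  then show ?thesis by linarith
qed

lemma H_infty_sublattice: "function_sublattice H_infty"
proof -
  have hom: "f (c *\<^sub>R \<phi>) = c * f \<phi>" if "f \<in> H_infty" "0 \<le> c"
    for f :: "('a \<Rightarrow>\<^sub>L real) \<Rightarrow> real" and c \<phi>
    using that unfolding H_infty_def pos_homogeneous_def by blast
  have bd: "\<bar>f \<phi>\<bar> \<le> fbl_norm f" if "f \<in> H_infty" "norm \<phi> \<le> 1"
    for f :: "('a \<Rightarrow>\<^sub>L real) \<Rightarrow> real" and \<phi>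
    unfolding fbl_norm_def using that by (intro cSUP_upper) (auto simp: H_infty_def)
  show ?thesis
    unfolding function_sublattice_def
  proof (intro conjI ballI allI)
    show "(\<lambda>_. 0) \<in> (H_infty :: (('a \<Rightarrow>\<^sub>L real) \<Rightarrow> real) set)"
      by (rule H_infty_I[where C = 0]) (auto simp: pos_homogeneous_def)
  next
    fix f g :: "('a \<Rightarrow>\<^sub>L real) \<Rightarrow> real" assume fg: "f \<in> H_infty" "g \<in> H_infty"
    show "(\<lambda>t. f t + g t) \<in> H_infty"
    proof (rule H_infty_I)
      show "(\<lambda>t. f t + g t) \<in> pos_homogeneous"
        using hom[OF fg(1)] hom[OF fg(2)] by (simp add: pos_homogeneous_def algebra_simps)
      fix \<phi> :: "'a \<Rightarrow>\<^sub>L real" assume "norm \<phi> \<le> 1"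
      then show "\<bar>f \<phi> + g \<phi>\<bar> \<le> fbl_norm f + fbl_norm g"
        using bd[OF fg(1)] bd[OF fg(2)] abs_triangle_ineq[of "f \<phi>" "g \<phi>"] by (meson add_mono order_trans)
    qed
    have "\<bar>max x y\<bar> \<le> a + b" "\<bar>min x y\<bar> \<le> a + b"
      if "\<bar>x\<bar> \<le> a" "\<bar>y\<bar> \<le> b" for a b x y :: real
      using that by linarith+
    moreover have "sup f g \<in> pos_homogeneous" "inf f g \<in> pos_homogeneous"
      using hom[OF fg(1)] hom[OF fg(2)]
      by (simp_all add: pos_homogeneous_def sup_max inf_min max_mult_distrib_left min_mult_distrib_left)
    ultimately show "sup f g \<in> H_infty" "inf f g \<in> H_infty"
      using bd[OF fg(1)] bd[OF fg(2)]
      by (simp_all add: H_infty_I[where C = "fbl_norm f + fbl_norm g"] sup_max inf_min)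
  next
    fix c :: real and f :: "('a \<Rightarrow>\<^sub>L real) \<Rightarrow> real" assume f: "f \<in> H_infty"
    show "(\<lambda>t. c * f t) \<in> H_infty"
      using hom[OF f] bd[OF f]
      by (intro H_infty_I[where C = "\<bar>c\<bar> * fbl_norm f"])
         (auto simp: pos_homogeneous_def abs_mult mult_left_mono)
  qed
qed

lemma dual_eval_H_infty: "dual_eval x \<in> H_infty"
proof (rule H_infty_I[where C = "norm x"])
  show "dual_eval x \<in> pos_homogeneous"
    by (auto simp: pos_homogeneous_def dual_eval_def blinfun.scaleR_left)
  fix \<phi> :: "'a \<Rightarrow>\<^sub>L real" assume "norm \<phi> \<le> 1"
  then have "norm \<phi> * norm x \<le> 1 * norm x" by (intro mult_right_mono) auto
  then show "\<bar>dual_eval x \<phi>\<bar> \<le> norm x"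
    using norm_blinfun[of \<phi> x] by (simp add: dual_eval_def)
qed

lemma FBL_infty_least:
  assumes "X \<subseteq> H_infty" "function_sublattice X" "fbl_norm_closed X" "range dual_eval \<subseteq> X"
  shows "FBL_infty \<subseteq> X"
  using assms unfolding FBL_infty_def by blast

lemma FBL_infty_subset: "FBL_infty \<subseteq> H_infty"
  by (rule FBL_infty_least)
     (auto simp: H_infty_sublattice dual_eval_H_infty fbl_norm_closed_def)

lemma dual_eval_FBL_infty: "dual_eval x \<in> FBL_infty"
  unfolding FBL_infty_def by auto

lemma FBL_infty_sublattice: "function_sublattice FBL_infty"
  unfolding FBL_infty_def function_sublattice_def by auto

lemma FBL_infty_closed: "fbl_norm_closed FBL_infty"
  unfolding fbl_norm_closed_def
proof (intro ballI impI)
  fix f :: "('a \<Rightarrow>\<^sub>L real) \<Rightarrow> real"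
  assume f: "f \<in> H_infty" "\<forall>e>0. \<exists>g\<in>FBL_infty. fbl_norm (\<lambda>\<phi>. f \<phi> - g \<phi>) < e"
  show "f \<in> FBL_infty"
    unfolding FBL_infty_def
  proof (rule InterI, clarify)
    fix X :: "(('a \<Rightarrow>\<^sub>L real) \<Rightarrow> real) set"
    assume X: "X \<subseteq> H_infty" "function_sublattice X" "fbl_norm_closed X" "range dual_eval \<subseteq> X"
    have "\<forall>e>0. \<exists>g\<in>X. fbl_norm (\<lambda>\<phi>. f \<phi> - g \<phi>) < e"
      using f(2) FBL_infty_least[OF X] by blast
    then show "f \<in> X" using X(3) f(1) unfolding fbl_norm_closed_def by blast
  qed
qed

lemma norm_adjoint_op: "norm (adjoint_op T \<phi>) \<le> norm T * norm \<phi>"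
  unfolding adjoint_op_def using norm_blinfun_compose[of \<phi> T] by (simp add: mult.commute)

lemma free_hom_dual_eval: "free_hom T (dual_eval x) = dual_eval (blinfun_apply T x)"
  by (auto simp: free_hom_def dual_eval_def adjoint_op_def)

lemma free_hom_abs_le:
  assumes "f \<in> H_infty" "norm \<phi> \<le> 1"
  shows "\<bar>free_hom T f \<phi>\<bar> \<le> norm T * fbl_norm f"
proof -
  have "norm (adjoint_op T \<phi>) \<le> norm T * 1"
    using norm_adjoint_op[of T \<phi>] assms(2) by (meson mult_left_mono norm_ge_zero order_trans)
  then have "fbl_norm f * norm (adjoint_op T \<phi>) \<le> fbl_norm f * (norm T * 1)"
    using fbl_norm_nonneg[OF assms(1)] by (rule mult_left_mono)
  then show ?thesis
    using abs_le_fbl_norm[OF assms(1), of "adjoint_op T \<phi>"]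
    by (simp add: free_hom_def mult.commute)
qed

lemma free_hom_bounded:
  assumes "f \<in> H_infty"
  shows "fbl_norm (free_hom T f) \<le> norm T * fbl_norm f"
  by (rule fbl_norm_le) (rule free_hom_abs_le[OF assms])

lemma free_hom_H_infty:
  assumes "f \<in> H_infty"
  shows "free_hom T f \<in> H_infty"
proof (rule H_infty_I[OF _ free_hom_abs_le[OF assms]])
  have "adjoint_op T (c *\<^sub>R \<phi>) = c *\<^sub>R adjoint_op T \<phi>" for c \<phi>
    by (rule blinfun_eqI) (simp add: adjoint_op_def blinfun.scaleR_left)
  then show "free_hom T f \<in> pos_homogeneous"
    using assms by (auto simp: H_infty_def pos_homogeneous_def free_hom_def)
qed

lemma free_hom_FBL_infty:
  fixes T :: "'a::banach \<Rightarrow>\<^sub>L 'b::banach"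
  assumes "f \<in> FBL_infty"
  shows "free_hom T f \<in> FBL_infty"
proof -
  let ?X = "{f \<in> H_infty. free_hom T f \<in> FBL_infty}"
  note H = H_infty_sublattice[where 'a = 'a] and G = FBL_infty_sublattice[where 'a = 'b]
  have ops: "free_hom T (\<lambda>_. 0) = (\<lambda>_. 0)"
    "free_hom T (\<lambda>t. f t + g t) = (\<lambda>t. free_hom T f t + free_hom T g t)"
    "free_hom T (\<lambda>t. c * f t) = (\<lambda>t. c * free_hom T f t)"
    "free_hom T (sup f g) = sup (free_hom T f) (free_hom T g)"
    "free_hom T (inf f g) = inf (free_hom T f) (free_hom T g)" for f g c
    by (auto simp: free_hom_def)
  have "FBL_infty \<subseteq> ?X"
  proof (rule FBL_infty_least)
    show "function_sublattice ?X"
      unfolding function_sublattice_def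
      by (simp add: ops sublatticeD[OF H] sublatticeD[OF G])
    show "fbl_norm_closed ?X"
      unfolding fbl_norm_closed_def
    proof (intro ballI impI)
      fix f assume f: "f \<in> H_infty" "\<forall>e>0. \<exists>g\<in>?X. fbl_norm (\<lambda>\<phi>. f \<phi> - g \<phi>) < e"
      have "\<exists>g\<in>FBL_infty. fbl_norm (\<lambda>\<phi>. free_hom T f \<phi> - g \<phi>) < e" if "e > 0" for e
      proof -
        have n: "0 < norm T + 1" by (simp add: add_nonneg_pos)
        then have "0 < e / (norm T + 1)" using that by (rule divide_pos_pos[rotated])
        then obtain g where g: "g \<in> ?X" "fbl_norm (\<lambda>\<phi>. f \<phi> - g \<phi>) < e / (norm T + 1)"
          using f(2) by blast
        have d: "(\<lambda>\<phi>. f \<phi> - g \<phi>) \<in> H_infty" using f(1) g(1) sublattice_diff[OF H] by blast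
        have "fbl_norm (free_hom T (\<lambda>\<phi>. f \<phi> - g \<phi>)) \<le> norm T * fbl_norm (\<lambda>\<phi>. f \<phi> - g \<phi>)"
          by (rule free_hom_bounded[OF d])
        also have "\<dots> \<le> (norm T + 1) * fbl_norm (\<lambda>\<phi>. f \<phi> - g \<phi>)"
          using fbl_norm_nonneg[OF d] by (intro mult_right_mono) auto
        also have "\<dots> < e"
          using g(2) by (simp only: pos_less_divide_eq[OF n] mult.commute)
        finally have "fbl_norm (\<lambda>\<phi>. free_hom T f \<phi> - free_hom T g \<phi>) < e"
          by (simp add: free_hom_def comp_def)
        then show ?thesis using g(1) by blast
      qed
      then have "free_hom T f \<in> FBL_infty"
        using free_hom_H_infty[OF f(1), of T] FBL_infty_closed[where 'a = 'b]
        unfolding fbl_norm_closed_def by blast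
      then show "f \<in> ?X" using f(1) by blast
    qed
    show "range dual_eval \<subseteq> ?X"
      by (auto simp: free_hom_dual_eval dual_eval_FBL_infty dual_eval_H_infty)
  qed auto
  then show ?thesis using assms by blast
qed

lemma free_hom_lattice_hom: "lattice_hom_on FBL_infty FBL_infty (free_hom T)"
  unfolding lattice_hom_on_def
  by (auto simp: free_hom_FBL_infty) (auto simp: free_hom_def)

lemma free_hom_unique:
  fixes T :: "'b::banach \<Rightarrow>\<^sub>L 'a::banach"
  assumes S: "lattice_hom_on FBL_infty FBL_infty S"
    and bounded: "\<And>f. f \<in> FBL_infty \<Longrightarrow> fbl_norm (S f) \<le> C * fbl_norm f"
    and ext: "\<And>x. S (dual_eval x) = dual_eval (blinfun_apply T x)"
    and f: "f \<in> FBL_infty"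
  shows "S f = free_hom T f"
proof -
  let ?X = "{f \<in> FBL_infty. S f = free_hom T f}"
  have Sadd: "S (\<lambda>t. f t + g t) = (\<lambda>t. S f t + S g t)"
    if "f \<in> FBL_infty" "g \<in> FBL_infty" for f g
    using S that unfolding lattice_hom_on_def by blast
  have Smult: "S (\<lambda>t. c * f t) = (\<lambda>t. c * S f t)" if "f \<in> FBL_infty" for c f
    using S that unfolding lattice_hom_on_def by blast
  have Slat: "S (sup f g) = sup (S f) (S g)" "S (inf f g) = inf (S f) (S g)"
    if "f \<in> FBL_infty" "g \<in> FBL_infty" for f g
    using S that unfolding lattice_hom_on_def by blast+
  have zero: "(\<lambda>_. 0) \<in> (FBL_infty :: (('b \<Rightarrow>\<^sub>L real) \<Rightarrow> real) set)"
    using FBL_infty_sublattice unfolding function_sublattice_def by blast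
  have S0: "S (\<lambda>_. 0) = (\<lambda>_. 0)"
    using Smult[of "\<lambda>_. 0" 0] zero by simp
  have "FBL_infty \<subseteq> ?X"
  proof (rule FBL_infty_least)
    show "?X \<subseteq> H_infty" using FBL_infty_subset by blast
    show "function_sublattice ?X"
      unfolding function_sublattice_def
      by (simp add: Sadd Smult Slat S0 sublatticeD[OF FBL_infty_sublattice])
         (auto simp: free_hom_def)
    show "range dual_eval \<subseteq> ?X"
      by (auto simp: ext free_hom_dual_eval dual_eval_FBL_infty)
    show "fbl_norm_closed ?X"
      unfolding fbl_norm_closed_def
    proof (intro ballI impI)
      fix f assume f: "f \<in> H_infty" "\<forall>e>0. \<exists>g\<in>?X. fbl_norm (\<lambda>\<phi>. f \<phi> - g \<phi>) < e"
      have fF: "f \<in> FBL_infty"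
        using f FBL_infty_closed unfolding fbl_norm_closed_def by blast
      have "S f \<phi> = free_hom T f \<phi>" for \<phi>
      proof -
        let ?K = "(\<bar>C\<bar> + norm T) * norm \<phi>"
        have K: "0 \<le> ?K" by (simp add: add_nonneg_nonneg)
        have "\<bar>S f \<phi> - free_hom T f \<phi>\<bar> \<le> 0 + e" if "e > 0" for e
        proof -
          have "0 < e / (?K + 1)" using that K by (intro divide_pos_pos) linarith+
          then obtain g where g: "g \<in> ?X" "fbl_norm (\<lambda>\<phi>. f \<phi> - g \<phi>) < e / (?K + 1)"
            using f(2) by blast
          let ?d = "\<lambda>\<phi>. f \<phi> - g \<phi>"
          have d: "?d \<in> FBL_infty" using fF g(1) sublattice_diff[OF FBL_infty_sublattice] by blast
          then have dH: "?d \<in> H_infty" using FBL_infty_subset by blast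
          have nn: "0 \<le> fbl_norm ?d" by (rule fbl_norm_nonneg[OF dH])
          have SdH: "S ?d \<in> H_infty"
            using S d FBL_infty_subset unfolding lattice_hom_on_def by blast
          have "S (\<lambda>t. ?d t + g t) = (\<lambda>t. S ?d t + S g t)"
            using Sadd[OF d, of g] g(1) by blast
          then have Sd: "S f \<phi> = S ?d \<phi> + free_hom T g \<phi>" using g(1) by simp
          have Td: "free_hom T f \<phi> = free_hom T ?d \<phi> + free_hom T g \<phi>" by (simp add: free_hom_def)
          have "\<bar>S ?d \<phi>\<bar> \<le> fbl_norm (S ?d) * norm \<phi>" by (rule abs_le_fbl_norm[OF SdH])
          also have "\<dots> \<le> (\<bar>C\<bar> * fbl_norm ?d) * norm \<phi>"
            using bounded[OF d] nn
            by (intro mult_right_mono) (auto intro: order_trans[OF _ mult_right_mono[of C "\<bar>C\<bar>"]])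
          finally have 1: "\<bar>S ?d \<phi>\<bar> \<le> \<bar>C\<bar> * fbl_norm ?d * norm \<phi>" .
          have "\<bar>free_hom T ?d \<phi>\<bar> \<le> fbl_norm (free_hom T ?d) * norm \<phi>"
            by (rule abs_le_fbl_norm[OF free_hom_H_infty[OF dH]])
          also have "\<dots> \<le> (norm T * fbl_norm ?d) * norm \<phi>"
            by (intro mult_right_mono free_hom_bounded[OF dH]) auto
          finally have 2: "\<bar>free_hom T ?d \<phi>\<bar> \<le> norm T * fbl_norm ?d * norm \<phi>" .
          have "\<bar>S f \<phi> - free_hom T f \<phi>\<bar> \<le> \<bar>S ?d \<phi>\<bar> + \<bar>free_hom T ?d \<phi>\<bar>"
            using Sd Td by linarith
          also have "\<dots> \<le> ?K * fbl_norm ?d" using 1 2 by (simp add: algebra_simps)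
          also have "\<dots> \<le> (?K + 1) * fbl_norm ?d" using nn by (intro mult_right_mono) auto
          also have "\<dots> \<le> e"
          proof -
            have "0 < ?K + 1" using K by linarith
            then have "fbl_norm ?d * (?K + 1) < e" using g(2) by (simp only: pos_less_divide_eq)
            then show ?thesis by (subst mult.commute) linarith
          qed
          finally show ?thesis by simp
        qed
        then have "\<bar>S f \<phi> - free_hom T f \<phi>\<bar> \<le> 0" by (rule field_le_epsilon)
        then show ?thesis by simp
      qed
      then show "f \<in> ?X" using fF by blast
    qed
  qed
  then show ?thesis using f by blast
qed

text \<open>For \<open>T = 0\<close> the induced homomorphism is 0, hence order continuous, whether or not \<open>T\<close> is
  injective.\<close>

lemma order_continuous_free_hom_zero:
  "order_continuous_on FBL_infty FBL_infty
     (free_hom (0 :: 'b::banach \<Rightarrow>\<^sub>L 'a::banach))"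
proof -
  have "f 0 = 0" if "f \<in> FBL_infty" for f :: "('b \<Rightarrow>\<^sub>L real) \<Rightarrow> real"
    using abs_le_fbl_norm[of f 0] that FBL_infty_subset by auto
  moreover have "adjoint_op (0 :: 'b \<Rightarrow>\<^sub>L 'a) \<phi> = 0" for \<phi>
    by (rule blinfun_eqI) (simp add: adjoint_op_def)
  ultimately have zero: "free_hom (0 :: 'b \<Rightarrow>\<^sub>L 'a) f = (\<lambda>_. 0)" if "f \<in> FBL_infty" for f
    using that by (auto simp: free_hom_def)
  have mem: "(\<lambda>_. 0) \<in> (FBL_infty :: (('a \<Rightarrow>\<^sub>L real) \<Rightarrow> real) set)"
    using FBL_infty_sublattice unfolding function_sublattice_def by blast
  have "decreases_to_zero FBL_infty I le (\<lambda>i. free_hom (0 :: 'b \<Rightarrow>\<^sub>L 'a) (f i))"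
    if I: "directed_index I le" and f: "decreases_to_zero FBL_infty I le f"
    for I :: "(('b \<Rightarrow>\<^sub>L real) \<Rightarrow> real) set" and le f
  proof -
    have "I \<noteq> {}" using I unfolding directed_index_def by blast
    moreover have "free_hom (0 :: 'b \<Rightarrow>\<^sub>L 'a) (f i) = (\<lambda>_. 0)" if "i \<in> I" for i
      using that f zero unfolding decreases_to_zero_def by blast
    ultimately show ?thesis
      using mem unfolding decreases_to_zero_def monotone_on_def by (auto simp: Pi_iff)
  qed
  then show ?thesis unfolding order_continuous_on_def by blast
qed

end

theory Submission
  imports Defs
begin

text \<open>(2) If \<open>T p = 0 \<noteq> p\<close> and \<open>T q \<noteq> 0\<close>, the functions \<open>(\<bar>\<delta>\<^sub>q\<bar> - n \<bar>\<delta>\<^sub>p\<bar>)\<^sup>+\<close>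
  decrease to 0, because they vanish eventually off the nowhere dense hyperplane \<open>\<delta>\<^sub>p = 0\<close>; but
  their images are all equal to \<open>\<bar>\<delta>\<^bsub>Tq\<^esub>\<bar>\<close>.

  (1) \<open>T*\<close> is onto and open for the bounded weak* topologies. If \<open>g \<le> f\<^sub>i \<circ> T*\<close> for all \<open>i\<close> and
  \<open>g y > c > 0\<close>, then \<open>f\<^sub>i > c\<close> on the bounded weak* open set \<open>T*{g > c}\<close> around \<open>\<theta> = T* y\<close>. By
  Banach--Dieudonne that set contains \<open>{\<phi>. \<forall>a. \<bar>(\<phi> - \<theta>)(a)\<bar> \<le> 1}\<close>, with \<open>a\<close> ranging over a norm-null
  sequence. With \<open>\<theta>(p) = 1\<close>, the function \<open>c (\<delta>\<^sub>p - sup\<^sub>a \<bar>\<delta>\<^sub>a - \<theta>(a) \<delta>\<^sub>p\<bar>)\<^sup>+\<close> is then a nonzero lower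
  bound of the \<open>f\<^sub>i\<close>, and it lies in the lattice because the sequence is null.\<close>

section \<open>The Hahn--Banach and Banach--Alaoglu theorems\<close>

text \<open>Scaling is stated as an inequality for \<open>c > 0\<close>, a form that passes easily
  to infima. Applying it to \<open>1 / c\<close> recovers equality in
  \<open>sublinear_scale\<close>, and the factor \<open>1/2\<close> gives the value at 0.\<close>

definition sublinear :: "('a::real_vector \<Rightarrow> real) \<Rightarrow> bool" where
  "sublinear q \<longleftrightarrow>
     (\<forall>x y. q (x + y) \<le> q x + q y) \<and> (\<forall>c>0. \<forall>x. q (c *\<^sub>R x) \<le> c * q x)"

lemma sublinearD:
  assumes "sublinear q"
  shows "q (x + y) \<le> q x + q y" and "0 < c \<Longrightarrow> q (c *\<^sub>R x) \<le> c * q x"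
  using assms unfolding sublinear_def by blast+

lemma sublinear_zero:
  assumes "sublinear q"
  shows "q 0 = 0"
  using sublinearD(1)[OF assms, of 0 0] sublinearD(2)[OF assms, of "1/2" 0] by simp

lemma sublinear_neg:
  assumes "sublinear q"
  shows "0 \<le> q x + q (- x)"
  using sublinearD(1)[OF assms, of x "- x"] sublinear_zero[OF assms] by simp

lemma sublinear_scale:
  assumes q: "sublinear q" and c: "0 < c"
  shows "q (c *\<^sub>R x) = c * q x"
proof (rule antisym)
  show "q (c *\<^sub>R x) \<le> c * q x" using sublinearD(2)[OF q c] .
  have "q ((1 / c) *\<^sub>R (c *\<^sub>R x)) \<le> (1 / c) * q (c *\<^sub>R x)"
    using c by (intro sublinearD(2)[OF q]) simp
  then show "c * q x \<le> q (c *\<^sub>R x)" using c by (simp add: field_simps)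
qed

lemma sublinear_norm: "0 \<le> M \<Longrightarrow> sublinear (\<lambda>x. M * norm x)"
  unfolding sublinear_def
  by (auto simp: norm_triangle_ineq mult_left_mono simp flip: distrib_left)

text \<open>The infimal convolution of \<open>p\<close> with the cone \<open>G\<close>.\<close>

lemma sublinear_below_cone:
  fixes p :: "'a::real_vector \<Rightarrow> real"
  assumes p: "sublinear p"
    and G0: "(0, 0) \<in> G"
    and Gadd: "\<And>u v. u \<in> G \<Longrightarrow> v \<in> G \<Longrightarrow> u + v \<in> G"
    and Gmult: "\<And>c u. 0 < c \<Longrightarrow> u \<in> G \<Longrightarrow> c *\<^sub>R u \<in> G"
    and Gp: "\<And>w r. (w, r) \<in> G \<Longrightarrow> - r \<le> p (- w)"
  shows "\<exists>q. sublinear q \<and> q \<le> p \<and> (\<forall>(w, r)\<in>G. q w \<le> r)"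
proof -
  define F where "F x u = p (x - fst u) + snd u" for x and u :: "'a \<times> real"
  define q where "q x = (INF u\<in>G. F x u)" for x
  \<comment> \<open>\<open>Gp\<close> makes the infimum finite: for \<open>u = (w, r)\<close>,
    subadditivity gives
    \<open>p (x - w) + r \<ge> p (- w) - p (- x) + r \<ge> - p (- x)\<close>.\<close>
  have bdd: "bdd_below (F x ` G)" for x
  proof (rule bdd_belowI2)
    fix u assume u: "u \<in> G"
    have "p (- fst u) \<le> p (x - fst u) + p (- x)"
      using sublinearD(1)[OF p, of "x - fst u" "- x"] by simp
    then show "- p (- x) \<le> F x u"
      using Gp[of "fst u" "snd u"] u by (simp add: F_def)
  qed
  have q_le: "q x \<le> F x u" if "u \<in> G" for x u
    unfolding q_def using bdd that by (rule cINF_lower)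
  have ge_q: "m \<le> q x" if "\<And>u. u \<in> G \<Longrightarrow> m \<le> F x u" for x m
    unfolding q_def using G0 that by (intro cINF_greatest) auto
  have "sublinear q"
    unfolding sublinear_def
  proof (intro conjI allI impI)
    fix x y
    have "q (x + y) \<le> F x u + F y v" if "u \<in> G" "v \<in> G" for u v
    proof -
      have "q (x + y) \<le> F (x + y) (u + v)" by (rule q_le[OF Gadd[OF that]])
      also have "\<dots> \<le> F x u + F y v"
        using sublinearD(1)[OF p, of "x - fst u" "y - fst v"] by (simp add: F_def algebra_simps)
      finally show ?thesis .
    qed
    then have "q (x + y) - F x u \<le> q y" if "u \<in> G" for u
      using that by (intro ge_q) (auto simp: algebra_simps)
    then have "q (x + y) - q y \<le> q x"
      by (intro ge_q) (auto simp: algebra_simps)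
    then show "q (x + y) \<le> q x + q y" by simp
  next
    fix c x assume c: "0 < (c::real)"
    have "q (c *\<^sub>R x) / c \<le> F x u" if "u \<in> G" for u
    proof -
      have "q (c *\<^sub>R x) \<le> F (c *\<^sub>R x) (c *\<^sub>R u)" by (rule q_le[OF Gmult[OF c that]])
      also have "\<dots> = c * F x u"
        using sublinear_scale[OF p c, of "x - fst u"] by (simp add: F_def algebra_simps)
      finally show ?thesis using c by (simp add: field_simps)
    qed
    then have "q (c *\<^sub>R x) / c \<le> q x" by (rule ge_q)
    then show "q (c *\<^sub>R x) \<le> c * q x" using c by (simp add: field_simps)
  qed
  moreover have "q x \<le> p x" for x
    using q_le[OF G0, of x] by (simp add: F_def)
  moreover have "q w \<le> r" if "(w, r) \<in> G" for w r
    using q_le[OF that, of w] by (simp add: F_def sublinear_zero[OF p])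
  ultimately show ?thesis by (auto simp: le_fun_def)
qed

text \<open>Zorn's lemma for the reversed order. The pointwise infimum of a chain is finite because
  every member is at least \<open>- p (- x)\<close>, and it is subadditive because the smaller of
  two members can serve both arguments.\<close>

lemma minimal_sublinear_exists:
  fixes p :: "'a::real_vector \<Rightarrow> real"
  assumes p: "sublinear p"
  shows "\<exists>q. sublinear q \<and> q \<le> p \<and> (\<forall>q'. sublinear q' \<longrightarrow> q' \<le> q \<longrightarrow> q' = q)"
proof -
  let ?A = "{q. sublinear q \<and> q \<le> p}"
  have "\<exists>m\<in>?A. \<forall>a\<in>?A. m \<ge> a \<longrightarrow> a = m"
  proof (rule predicate_Zorn)
    show "partial_order_on ?A (relation_of (\<ge>) ?A)"
      by (auto simp: partial_order_on_def preorder_on_def refl_on_def trans_def antisym_def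
          relation_of_def)
  next
    fix C assume C: "C \<in> Chains (relation_of (\<ge>) ?A)"
    show "\<exists>u\<in>?A. \<forall>a\<in>C. a \<ge> u"
    proof (cases "C = {}")
      case True
      then show ?thesis using p by auto
    next
      case False
      have CA: "sublinear q" "q \<le> p" if "q \<in> C" for q
        using C that unfolding Chains_def relation_of_def by blast+
      have chain: "q \<le> q' \<or> q' \<le> q" if "q \<in> C" "q' \<in> C" for q q'
        using C that unfolding Chains_def relation_of_def by blast
      define u where "u x = (INF q\<in>C. q x)" for x
      have bdd: "bdd_below ((\<lambda>q. q x) ` C)" for x
      proof (rule bdd_belowI2)
        fix q assume "q \<in> C"
        then show "- p (- x) \<le> q x"
          using sublinear_neg[OF CA(1), of q x] CA(2)[of q] unfolding le_fun_def
          by (smt (verit))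
      qed
      have u_le: "u x \<le> q x" if "q \<in> C" for x q
        unfolding u_def using bdd that by (rule cINF_lower)
      have ge_u: "m \<le> u x" if "\<And>q. q \<in> C \<Longrightarrow> m \<le> q x" for m x
        unfolding u_def using False that by (intro cINF_greatest) auto
      have "sublinear u"
        unfolding sublinear_def
      proof (intro conjI allI impI)
        fix x y
        have "u (x + y) \<le> q x + q' y" if "q \<in> C" "q' \<in> C" for q q'
        proof -
          have "u (x + y) \<le> q x + q y" "u (x + y) \<le> q' x + q' y"
            using u_le[of q "x + y"] u_le[of q' "x + y"] that
              sublinearD(1)[OF CA(1), of q x y] sublinearD(1)[OF CA(1), of q' x y] by linarith+
          then show ?thesis
            using chain[OF that] by (auto simp: le_fun_def) (meson add_left_mono add_right_mono order_trans)+
        qed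
        then have "u (x + y) - q x \<le> u y" if "q \<in> C" for q
          using that by (intro ge_u) (simp add: diff_le_eq add.commute[of _ "q x"])
        then have "u (x + y) - u y \<le> u x"
          by (intro ge_u) (auto simp: algebra_simps)
        then show "u (x + y) \<le> u x + u y" by simp
      next
        fix c x assume c: "0 < (c::real)"
        have "u (c *\<^sub>R x) / c \<le> q x" if "q \<in> C" for q
          using u_le[OF that, of "c *\<^sub>R x"] sublinearD(2)[OF CA(1)[OF that] c, of x] c
          by (simp add: field_simps)
        then have "u (c *\<^sub>R x) / c \<le> u x" by (rule ge_u)
        then show "u (c *\<^sub>R x) \<le> c * u x" using c by (simp add: field_simps)
      qed
      moreover have "u \<le> q" if "q \<in> C" for q
        using u_le[OF that] by (auto simp: le_fun_def)
      ultimately show ?thesis using False CA(2) order_trans by blast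
    qed
  qed
  then obtain m where m: "m \<in> ?A" "\<And>a. a \<in> ?A \<Longrightarrow> a \<le> m \<Longrightarrow> a = m" by blast
  have "q' = m" if "sublinear q'" "q' \<le> m" for q'
    using m that order_trans by blast
  then show ?thesis using m(1) by blast
qed

text \<open>Convolving \<open>q\<close> with the ray through \<open>(- y, - q y)\<close> gives a
  sublinear functional below \<open>q\<close> whose value at \<open>- y\<close> is at most
  \<open>- q y\<close>. By minimality it equals \<open>q\<close>, so \<open>q\<close> is odd, and
  odd sublinear functionals are linear.\<close>

lemma minimal_sublinear_linear:
  fixes q :: "'a::real_vector \<Rightarrow> real"
  assumes q: "sublinear q" and min: "\<And>q'. sublinear q' \<Longrightarrow> q' \<le> q \<Longrightarrow> q' = q"
  shows "linear q"
proof -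
  have neg: "q (- y) = - q y" for y
  proof -
    let ?G = "{(- (t *\<^sub>R y), - (t * q y)) |t. 0 \<le> t}"
    have "\<exists>q'. sublinear q' \<and> q' \<le> q \<and> (\<forall>(w, r)\<in>?G. q' w \<le> r)"
    proof (rule sublinear_below_cone[OF q])
      show "(0, 0) \<in> ?G" by (rule CollectI) (rule exI[of _ 0], simp)
      fix u v assume "u \<in> ?G" "v \<in> ?G"
      then obtain s t where "0 \<le> s" "0 \<le> t" "u = (- (s *\<^sub>R y), - (s * q y))" "v = (- (t *\<^sub>R y), - (t * q y))"
        by blast
      then show "u + v \<in> ?G"
        by (intro CollectI exI[of _ "s + t"]) (simp add: algebra_simps)
    next
      fix c :: real and u assume "0 < c" "u \<in> ?G"
      then obtain s where "0 \<le> s" "u = (- (s *\<^sub>R y), - (s * q y))"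
        by blast
      then show "c *\<^sub>R u \<in> ?G"
        using \<open>0 < c\<close> by (intro CollectI exI[of _ "c * s"]) simp
    next
      fix w r assume "(w, r) \<in> ?G"
      then obtain t where t: "0 \<le> t" "w = - (t *\<^sub>R y)" "r = - (t * q y)" by blast
      show "- r \<le> q (- w)"
        using t sublinear_scale[OF q, of t y] sublinear_zero[OF q] by (cases "t = 0") auto
    qed
    then obtain q' where q': "sublinear q'" "q' \<le> q" "\<forall>(w, r)\<in>?G. q' w \<le> r" by blast
    have "(- (1 *\<^sub>R y), - (1 * q y)) \<in> ?G" using zero_le_one by blast
    then have "q' (- y) \<le> - q y" using q'(3) by fastforce
    then have "q (- y) \<le> - q y" using min[OF q'(1,2)] by simp
    then show ?thesis using sublinear_neg[OF q, of y] by linarith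
  qed
  show ?thesis
  proof (rule linearI)
    fix x y
    have "q x \<le> q (x + y) + q (- y)" using sublinearD(1)[OF q, of "x + y" "- y"] by simp
    then show "q (x + y) = q x + q y"
      using neg[of y] sublinearD(1)[OF q, of x y] by linarith
  next
    fix c :: real and x
    consider "c = 0" | "0 < c" | "0 < - c" by linarith
    then show "q (c *\<^sub>R x) = c *\<^sub>R q x"
    proof cases
      case 3
      then show ?thesis using sublinear_scale[OF q 3, of x] neg[of "c *\<^sub>R x"] by simp
    qed (auto simp: sublinear_zero[OF q] sublinear_scale[OF q])
  qed
qed

text \<open>The linear map \<open>j\<close> takes the place of a subspace; it will be a line through
  a vector, the identity, or the operator \<open>T\<close>. A minimal sublinear functional below the
  convolution of \<open>p\<close> with the graph of \<open>f\<close> along \<open>j\<close> is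
  linear and at most \<open>f\<close>; comparing at \<open>v\<close> and \<open>- v\<close> gives
  equality.\<close>

theorem Hahn_Banach_along:
  fixes j :: "'v::real_vector \<Rightarrow> 'w::real_vector" and f :: "'v \<Rightarrow> real"
  assumes p: "sublinear p" and j: "linear j" and f: "linear f"
    and le: "\<And>v. f v \<le> p (j v)"
  shows "\<exists>F. linear F \<and> F \<le> p \<and> (\<forall>v. F (j v) = f v)"
proof -
  let ?G = "range (\<lambda>v. (j v, f v))"
  have "\<exists>q. sublinear q \<and> q \<le> p \<and> (\<forall>(w, r)\<in>?G. q w \<le> r)"
  proof (rule sublinear_below_cone[OF p])
    show "(0, 0) \<in> ?G" using linear_0[OF j] linear_0[OF f] by (auto intro: range_eqI[of _ _ 0])
    show "u + v \<in> ?G" if "u \<in> ?G" "v \<in> ?G" for u v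
      using that by (auto simp flip: linear_add[OF j] linear_add[OF f])
    show "c *\<^sub>R u \<in> ?G" if "0 < c" "u \<in> ?G" for c u
      using that by (auto simp flip: linear_scale[OF j] linear_scale[OF f, simplified])
    show "- r \<le> p (- w)" if "(w, r) \<in> ?G" for w r
      using that le by (auto simp flip: linear_neg[OF j] linear_neg[OF f])
  qed
  then obtain q where q: "sublinear q" "q \<le> p" "\<And>v. q (j v) \<le> f v" by force
  obtain F where F: "sublinear F" "F \<le> q" "\<And>q'. sublinear q' \<Longrightarrow> q' \<le> F \<Longrightarrow> q' = F"
    using minimal_sublinear_exists[OF q(1)] by blast
  have lin: "linear F" using minimal_sublinear_linear[OF F(1) F(3)] .
  have Fj: "F (j v) \<le> f v" for v using F(2) q(3)[of v] unfolding le_fun_def by (meson order_trans)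
  have "F (j v) = f v" for v
    using Fj[of v] Fj[of "- v"] by (simp add: linear_neg[OF j] linear_neg[OF f] linear_neg[OF lin])
  then show ?thesis using lin F(2) q(2) order_trans by blast
qed

corollary Hahn_Banach_blinfun:
  fixes j :: "'v::real_vector \<Rightarrow> 'w::real_normed_vector" and f :: "'v \<Rightarrow> real"
  assumes j: "linear j" and f: "linear f" and M: "0 \<le> M"
    and le: "\<And>v. f v \<le> M * norm (j v)"
  shows "\<exists>\<phi> :: 'w \<Rightarrow>\<^sub>L real. norm \<phi> \<le> M \<and> (\<forall>v. blinfun_apply \<phi> (j v) = f v)"
proof -
  obtain F where F: "linear F" "F \<le> (\<lambda>w. M * norm w)" "\<And>v. F (j v) = f v"
    using Hahn_Banach_along[OF sublinear_norm[OF M] j f le] by blast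
  have abs: "\<bar>F w\<bar> \<le> M * norm w" for w
    using F(2)[THEN le_funD, of w] F(2)[THEN le_funD, of "- w"] by (simp add: linear_neg[OF F(1)])
  have bl: "bounded_linear F"
    using F(1) abs unfolding bounded_linear_def bounded_linear_axioms_def
    by (auto intro!: exI[of _ M] simp: mult.commute)
  then have "blinfun_apply (Blinfun F) = F" by (rule bounded_linear_Blinfun_apply)
  moreover have "norm (Blinfun F) \<le> M"
    using abs M by (intro norm_blinfun_bound) (simp_all add: calculation)
  ultimately show ?thesis using F(3) by metis
qed

corollary separating_functional:
  fixes p :: "'a::real_normed_vector"
  assumes "p \<noteq> 0"
  shows "\<exists>\<phi> :: 'a \<Rightarrow>\<^sub>L real. blinfun_apply \<phi> p = 1"
proof -
  have "\<exists>\<phi> :: 'a \<Rightarrow>\<^sub>L real. norm \<phi> \<le> 1 / norm p \<and> (\<forall>t. blinfun_apply \<phi> (t *\<^sub>R p) = t)"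
    using assms
    by (intro Hahn_Banach_blinfun linearI) (auto simp: algebra_simps)
  then show ?thesis by (metis scaleR_one)
qed

text \<open>Banach--Alaoglu, phrased with basic weak* neighbourhoods.\<close>

theorem weak_star_compact_cball:
  fixes B :: "('a::real_normed_vector \<Rightarrow>\<^sub>L real) \<Rightarrow> 'a set" and d :: "('a \<Rightarrow>\<^sub>L real) \<Rightarrow> real"
  assumes B: "\<And>\<phi>. norm \<phi> \<le> R \<Longrightarrow> finite (B \<phi>)" and d: "\<And>\<phi>. norm \<phi> \<le> R \<Longrightarrow> 0 < d \<phi>"
  shows "\<exists>C. finite C \<and> (\<forall>\<phi>\<in>C. norm \<phi> \<le> R) \<and>
    (\<forall>\<psi>. norm \<psi> \<le> R \<longrightarrow> (\<exists>\<phi>\<in>C. \<forall>b\<in>B \<phi>. \<bar>blinfun_apply \<psi> b - blinfun_apply \<phi> b\<bar> < d \<phi>))"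
proof (cases "0 \<le> R")
  case False
  then have "\<not> norm \<psi> \<le> R" for \<psi> :: "'a \<Rightarrow>\<^sub>L real" using norm_ge_zero[of \<psi>] by linarith
  then show ?thesis by (intro exI[of _ "{}"]) auto
next
  case R: True
  \<comment> \<open>In the product topology the dual ball is the intersection of a box, compact by
    Tychonoff, with the closed set of linear functions.\<close>
  let ?K = "(blinfun_apply :: ('a \<Rightarrow>\<^sub>L real) \<Rightarrow> _) ` cball 0 R"
  let ?box = "PiE UNIV (\<lambda>x::'a. {- (R * norm x)..R * norm x})"
  have coord: "continuous_on UNIV (\<lambda>f::'a \<Rightarrow> real. f x)" for x
    by simp
  have "compactin (product_topology (\<lambda>_. euclidean) UNIV) ?box"
    unfolding compactin_PiE by auto
  then have "compact ?box" by (simp add: euclidean_product_topology)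
  moreover have "closed {f::'a \<Rightarrow> real. linear f}"
  proof -
    have "{f::'a \<Rightarrow> real. linear f} =
      (\<Inter>x. \<Inter>y. {f. f (x + y) = f x + f y}) \<inter> (\<Inter>c. \<Inter>x. {f. f (c *\<^sub>R x) = c * f x})"
      by (auto simp: linear_iff)
    also have "closed \<dots>"
      by (intro closed_Int closed_INT ballI closed_Collect_eq continuous_intros coord)
    finally show ?thesis .
  qed
  ultimately have "compact (?box \<inter> {f. linear f})" by (rule compact_Int_closed)
  also have "?box \<inter> {f. linear f} = ?K"
  proof (intro set_eqI iffI)
    fix f assume "f \<in> ?K"
    then obtain \<phi> :: "'a \<Rightarrow>\<^sub>L real" where \<phi>: "norm \<phi> \<le> R" "f = blinfun_apply \<phi>" by auto
    have "\<bar>blinfun_apply \<phi> x\<bar> \<le> R * norm x" for x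
      using norm_blinfun[of \<phi> x] mult_right_mono[OF \<phi>(1), of "norm x"] by simp
    then show "f \<in> ?box \<inter> {f. linear f}"
      using \<phi>(2) by (auto simp: abs_le_iff PiE_def minus_le_iff
          intro: bounded_linear.linear blinfun.bounded_linear_right)
  next
    fix f assume f: "f \<in> ?box \<inter> {f. linear f}"
    then have le: "\<bar>f x\<bar> \<le> R * norm x" for x by (auto simp: PiE_def Pi_def abs_le_iff minus_le_iff)
    \<comment> \<open>Hahn--Banach along the identity serves only to turn the bounded linear
      function \<open>f\<close> into a \<open>blinfun\<close> with the norm bound
      \<open>R\<close>.\<close>
    have "\<exists>\<phi> :: 'a \<Rightarrow>\<^sub>L real. norm \<phi> \<le> R \<and> (\<forall>v. blinfun_apply \<phi> v = f v)"
      using f le R by (intro Hahn_Banach_blinfun linear_ident) (auto simp: abs_le_iff)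
    then obtain \<phi> :: "'a \<Rightarrow>\<^sub>L real" where "norm \<phi> \<le> R" "f = blinfun_apply \<phi>"
      by (metis ext)
    then show "f \<in> ?K" by auto
  qed
  finally have K: "compact ?K" .
  define U where "U \<phi> = (\<Inter>b\<in>B \<phi>. {f. \<bar>f b - blinfun_apply \<phi> b\<bar> < d \<phi>})" for \<phi>
  obtain C where C: "C \<subseteq> cball 0 R" "finite C" "?K \<subseteq> (\<Union>\<phi>\<in>C. U \<phi>)"
  proof (rule compactE_image[OF K])
    show "open (U \<phi>)" if "\<phi> \<in> cball 0 R" for \<phi>
      unfolding U_def using B that
      by (intro open_INT ballI open_Collect_less continuous_intros coord) auto
    show "?K \<subseteq> (\<Union>\<phi>\<in>cball 0 R. U \<phi>)"
      using d by (auto simp: U_def)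
  qed
  have "\<exists>\<phi>\<in>C. \<forall>b\<in>B \<phi>. \<bar>blinfun_apply \<psi> b - blinfun_apply \<phi> b\<bar> < d \<phi>" if "norm \<psi> \<le> R" for \<psi>
  proof -
    have "blinfun_apply \<psi> \<in> ?K" using that by auto
    then show ?thesis using C(3) unfolding U_def by blast
  qed
  then show ?thesis using C(1,2) by (intro exI[of _ C]) auto
qed

section \<open>Operators with closed range\<close>

text \<open>Baire category for the closures of the images of balls, followed by the successive
  approximation argument of the open mapping theorem.\<close>

theorem bounded_below_of_closed_range:
  fixes T :: "'f::banach \<Rightarrow>\<^sub>L 'e::banach"
  assumes inj: "inj (blinfun_apply T)" and closed: "closed (range (blinfun_apply T))"
  shows "\<exists>C>0. \<forall>x. norm x \<le> C * norm (blinfun_apply T x)"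
proof -
  let ?S = "range (blinfun_apply T)"
  define G where "G n = closure (blinfun_apply T ` cball 0 (real n))" for n
  have GS: "G n \<subseteq> ?S" for n
    unfolding G_def by (rule closure_minimal[OF _ closed]) auto
  \<comment> \<open>Baire's theorem is applied inside the range, which is completely metrizable
    because it is closed and which the \<open>G n\<close> cover.\<close>
  have "\<exists>n. top_of_set ?S interior_of G n \<noteq> {}"
  proof (rule ccontr)
    assume "\<not> ?thesis"
    moreover have "closedin (top_of_set ?S) (G n)" for n
      by (rule closed_subset[OF GS]) (simp add: G_def)
    ultimately have "top_of_set ?S interior_of \<Union>(range G) = {}"
      using completely_metrizable_space_closedin[OF completely_metrizable_space_euclidean, of ?S] closed
      by (intro Baire_category_alt) auto
    moreover have "\<Union>(range G) = ?S"
    proof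
      show "\<Union>(range G) \<subseteq> ?S" using GS by blast
      have "blinfun_apply T x \<in> \<Union>(range G)" for x
      proof -
        obtain n where "norm x \<le> real n" using real_arch_simple by blast
        then have "blinfun_apply T x \<in> G n"
          unfolding G_def by (intro closure_subset[THEN subsetD]) auto
        then show ?thesis by blast
      qed
      then show "?S \<subseteq> \<Union>(range G)" by blast
    qed
    ultimately show False
      using interior_of_topspace[of "top_of_set ?S"] by auto
  qed
  then obtain n s where "s \<in> top_of_set ?S interior_of G n" by blast
  then obtain U where U: "openin (top_of_set ?S) U" "s \<in> U" "U \<subseteq> G n"
    unfolding interior_of_def by blast
  then obtain r where r: "0 < r" "ball s r \<inter> ?S \<subseteq> U"
    unfolding openin_contains_ball by blast
  have sS: "s \<in> ?S" using U(2,3) GS by blast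
  \<comment> \<open>Both \<open>s\<close> and \<open>s + y\<close> lie in \<open>G n\<close>; the
    difference of their approximants moves the ball from \<open>s\<close> to the origin, at the
    price of doubling the norm bound.\<close>
  have approx0: "\<exists>x. norm x \<le> 2 * real n \<and> norm (y - blinfun_apply T x) < e"
    if y: "y \<in> ?S" "norm y < r" and e: "0 < e" for y e
  proof -
    have "s + y \<in> ?S"
      using sS y(1) by (auto simp flip: blinfun.add_right)
    moreover have "s + y \<in> ball s r" using y(2) by (simp add: dist_norm)
    ultimately have "s + y \<in> G n" using r(2) U(3) by blast
    moreover have "s \<in> G n" using U by blast
    moreover have "\<exists>a. norm a \<le> real n \<and> dist (blinfun_apply T a) t < e / 2" if "t \<in> G n" for t
      using that half_gt_zero[OF e] unfolding G_def closure_approachable by (fastforce simp: dist_norm)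
    ultimately obtain a b where
      "norm a \<le> real n" "dist (blinfun_apply T a) s < e / 2"
      "norm b \<le> real n" "dist (blinfun_apply T b) (s + y) < e / 2"
      by meson
    moreover have "y - blinfun_apply T (b - a) = (blinfun_apply T a - s) - (blinfun_apply T b - (s + y))"
      by (simp add: blinfun.diff_right)
    moreover from this have "norm (y - blinfun_apply T (b - a))
        \<le> norm (blinfun_apply T a - s) + norm (blinfun_apply T b - (s + y))"
      using norm_triangle_ineq4 by metis
    ultimately show ?thesis
      using norm_triangle_ineq4[of b a]
      by (intro exI[of _ "b - a"]) (simp only: dist_norm, linarith)
  qed
  \<comment> \<open>Dividing \<open>y\<close> by \<open>c = 2 * norm y / r\<close> gives norm
    \<open>r / 2 < r\<close>; scaling the bound \<open>2 * real n\<close> back by \<open>c\<close>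
    gives \<open>K * norm y\<close>.\<close>
  define K where "K = 4 * real n / r"
  have K: "0 \<le> K" using r(1) by (simp add: K_def)
  have approx: "\<exists>x. norm x \<le> K * norm y \<and> norm (y - blinfun_apply T x) \<le> norm y / 2"
    if y: "y \<in> ?S" for y
  proof (cases "y = 0")
    case True
    then show ?thesis by (intro exI[of _ 0]) simp
  next
    case False
    define c where "c = 2 * norm y / r"
    have c: "0 < c" using False r(1) by (simp add: c_def)
    obtain z where z: "y = blinfun_apply T z" using y by blast
    have "(1 / c) *\<^sub>R y \<in> ?S" unfolding z by (auto simp flip: blinfun.scaleR_right)
    moreover have "norm ((1 / c) *\<^sub>R y) < r" using c r(1) False by (simp add: c_def)
    moreover have "0 < norm y / (2 * c)" using False c by simp
    ultimately obtain x where
      x: "norm x \<le> 2 * real n" "norm ((1 / c) *\<^sub>R y - blinfun_apply T x) < norm y / (2 * c)"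
      using approx0 by blast
    have "norm (c *\<^sub>R x) = c * norm x" using c by simp
    also have "\<dots> \<le> c * (2 * real n)" using x(1) c by (intro mult_left_mono) auto
    also have "\<dots> = K * norm y" by (simp add: c_def K_def)
    finally have 1: "norm (c *\<^sub>R x) \<le> K * norm y" .
    have "y - blinfun_apply T (c *\<^sub>R x) = c *\<^sub>R ((1 / c) *\<^sub>R y - blinfun_apply T x)"
      using c by (simp add: blinfun.scaleR_right algebra_simps)
    then have "norm (y - blinfun_apply T (c *\<^sub>R x)) = c * norm ((1 / c) *\<^sub>R y - blinfun_apply T x)"
      using c by simp
    also have "\<dots> \<le> c * (norm y / (2 * c))"
      using x(2) c by (intro mult_left_mono) auto
    also have "\<dots> = norm y / 2" using c by simp
    finally show ?thesis using 1 by blast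
  qed
  \<comment> \<open>Subtracting from \<open>x\<close> an approximate preimage of \<open>T x\<close>
    halves the image at a cost controlled by \<open>K\<close>; iterating this yields a convergent
    series.\<close>
  have "\<exists>v. norm (x - v) \<le> K * norm (blinfun_apply T x) \<and>
      norm (blinfun_apply T v) \<le> norm (blinfun_apply T x) / 2" for x
  proof -
    obtain u where "norm u \<le> K * norm (blinfun_apply T x)"
      "norm (blinfun_apply T x - blinfun_apply T u) \<le> norm (blinfun_apply T x) / 2"
      using approx[of "blinfun_apply T x"] by blast
    then show ?thesis by (intro exI[of _ "x - u"]) (simp add: blinfun.diff_right)
  qed
  then obtain step where
    step: "\<And>x. norm (x - step x) \<le> K * norm (blinfun_apply T x)"
      "\<And>x. norm (blinfun_apply T (step x)) \<le> norm (blinfun_apply T x) / 2"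
    by metis
  \<comment> \<open>The geometric series gives the factor \<open>2 * K\<close>; the summand 1 makes
    the constant positive even if \<open>K = 0\<close>.\<close>
  have "norm x \<le> (2 * K + 1) * norm (blinfun_apply T x)" for x
  proof -
    \<comment> \<open>The remainders \<open>v k\<close> converge to \<open>x - suminf u\<close>
      while their images tend to 0, so injectivity forces \<open>x = suminf u\<close>.\<close>
    define v where "v k = (step ^^ k) x" for k
    define u where "u k = v k - v (Suc k)" for k
    let ?t = "norm (blinfun_apply T x)"
    have Tv: "norm (blinfun_apply T (v k)) \<le> ?t * (1/2) ^ k" for k
    proof (induction k)
      case (Suc k)
      then show ?case using step(2)[of "v k"] by (simp add: v_def)
    qed (simp add: v_def)
    have nu: "norm (u k) \<le> K * ?t * (1/2) ^ k" for k
    proof -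
      have "norm (u k) \<le> K * norm (blinfun_apply T (v k))"
        using step(1)[of "v k"] by (simp add: u_def v_def)
      also have "\<dots> \<le> K * (?t * (1/2) ^ k)" by (rule mult_left_mono[OF Tv K])
      finally show ?thesis by (simp add: mult.assoc)
    qed
    have geo: "(\<lambda>k. K * ?t * (1/2) ^ k) sums (K * ?t * 2)"
      using sums_mult[OF geometric_sums[of "1/2 :: real"], of "K * ?t"] by simp
    have sn: "summable (\<lambda>k. norm (u k))"
      by (rule summable_comparison_test'[OF sums_summable[OF geo], of 0]) (use nu in auto)
    have "(\<lambda>k. \<Sum>i<k. u i) \<longlonglongrightarrow> suminf u"
      by (rule summable_LIMSEQ[OF summable_norm_cancel[OF sn]])
    moreover have "(\<Sum>i<k. u i) = x - v k" for k
      unfolding u_def by (induction k) (simp_all add: v_def)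
    ultimately have "(\<lambda>k. x - (x - v k)) \<longlonglongrightarrow> x - suminf u"
      by (intro tendsto_diff tendsto_const) simp
    then have "v \<longlonglongrightarrow> x - suminf u" by simp
    then have "(\<lambda>k. blinfun_apply T (v k)) \<longlonglongrightarrow> blinfun_apply T (x - suminf u)"
      by (intro blinfun.tendsto tendsto_const)
    moreover have "(\<lambda>k. blinfun_apply T (v k)) \<longlonglongrightarrow> 0"
    proof (rule Lim_null_comparison)
      show "\<forall>\<^sub>F k in sequentially. norm (blinfun_apply T (v k)) \<le> ?t * (1/2) ^ k"
        using Tv by simp
      show "(\<lambda>k. ?t * (1/2) ^ k) \<longlonglongrightarrow> 0"
        by (intro tendsto_mult_right_zero LIMSEQ_power_zero) simp
    qed
    ultimately have "blinfun_apply T (x - suminf u) = blinfun_apply T 0"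
      using LIMSEQ_unique by (metis blinfun.zero_right)
    then have "x = suminf u" using injD[OF inj] by (metis right_minus_eq)
    then have "norm x \<le> (\<Sum>k. norm (u k))" using summable_norm[OF sn] by simp
    also have "\<dots> \<le> K * ?t * 2"
      using suminf_le[OF nu sn sums_summable[OF geo]] sums_unique[OF geo] by simp
    also have "\<dots> \<le> (2 * K + 1) * ?t" by (simp add: algebra_simps)
    finally show ?thesis .
  qed
  then show ?thesis using K by (intro exI[of _ "2 * K + 1"]) auto
qed

section \<open>The bounded weak* topology\<close>

text \<open>For \<open>R\<close> arbitrary, these are the neighbourhoods of the bounded weak* topology.\<close>

definition weak_star_near ::
  "real \<Rightarrow> ('a::real_normed_vector \<Rightarrow>\<^sub>L real) \<Rightarrow> (('a \<Rightarrow>\<^sub>L real) \<Rightarrow> bool) \<Rightarrow> bool" where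
  "weak_star_near R \<phi> P \<longleftrightarrow>
     (\<exists>B d. finite B \<and> 0 < d \<and>
       (\<forall>\<psi>. norm \<psi> \<le> R \<longrightarrow> (\<forall>b\<in>B. \<bar>blinfun_apply \<psi> b - blinfun_apply \<phi> b\<bar> < d) \<longrightarrow> P \<psi>))"

lemma weak_star_nearI:
  assumes "finite B" "0 < d"
    "\<And>\<psi>. norm \<psi> \<le> R \<Longrightarrow> (\<And>b. b \<in> B \<Longrightarrow> \<bar>blinfun_apply \<psi> b - blinfun_apply \<phi> b\<bar> < d) \<Longrightarrow> P \<psi>"
  shows "weak_star_near R \<phi> P"
  unfolding weak_star_near_def using assms by (intro exI[of _ B] exI[of _ d]) simp

lemma weak_star_nearE:
  assumes "weak_star_near R \<phi> P"
  obtains B d where "finite B" "0 < d"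
    "\<forall>\<psi>. norm \<psi> \<le> R \<longrightarrow> (\<forall>b\<in>B. \<bar>blinfun_apply \<psi> b - blinfun_apply \<phi> b\<bar> < d) \<longrightarrow> P \<psi>"
  using assms unfolding weak_star_near_def by blast

lemma weak_star_near_mono:
  assumes "weak_star_near R \<phi> P" "\<And>\<psi>. norm \<psi> \<le> R \<Longrightarrow> P \<psi> \<Longrightarrow> Q \<psi>"
  shows "weak_star_near R \<phi> Q"
  using assms unfolding weak_star_near_def by blast

lemma weak_star_near_conj:
  assumes "weak_star_near R \<phi> P" "weak_star_near R \<phi> Q"
  shows "weak_star_near R \<phi> (\<lambda>\<psi>. P \<psi> \<and> Q \<psi>)"
proof -
  obtain B d where 1: "finite B" "0 < d"
    "\<forall>\<psi>. norm \<psi> \<le> R \<longrightarrow> (\<forall>b\<in>B. \<bar>blinfun_apply \<psi> b - blinfun_apply \<phi> b\<bar> < d) \<longrightarrow> P \<psi>"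
    using assms(1) by (rule weak_star_nearE)
  obtain B' d' where 2: "finite B'" "0 < d'"
    "\<forall>\<psi>. norm \<psi> \<le> R \<longrightarrow> (\<forall>b\<in>B'. \<bar>blinfun_apply \<psi> b - blinfun_apply \<phi> b\<bar> < d') \<longrightarrow> Q \<psi>"
    using assms(2) by (rule weak_star_nearE)
  show ?thesis
  proof (rule weak_star_nearI[of "B \<union> B'" "min d d'"])
    show "finite (B \<union> B')" "0 < min d d'" using 1(1,2) 2(1,2) by simp_all
    fix \<psi> assume \<psi>: "norm \<psi> \<le> R"
      "\<And>b. b \<in> B \<union> B' \<Longrightarrow> \<bar>blinfun_apply \<psi> b - blinfun_apply \<phi> b\<bar> < min d d'"
    have "P \<psi>" using \<psi>(1) by (rule 1(3)[rule_format]) (use \<psi>(2) in force)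
    moreover have "Q \<psi>" using \<psi>(1) by (rule 2(3)[rule_format]) (use \<psi>(2) in force)
    ultimately show "P \<psi> \<and> Q \<psi>" ..
  qed
qed

lemma weak_star_near_translate:
  assumes "weak_star_near (R + norm \<theta>) (\<theta> + \<phi>) P"
  shows "weak_star_near R \<phi> (\<lambda>\<psi>. P (\<theta> + \<psi>))"
proof -
  obtain B d where B: "finite B" "0 < d" and P: "\<forall>\<psi>. norm \<psi> \<le> R + norm \<theta> \<longrightarrow>
      (\<forall>b\<in>B. \<bar>blinfun_apply \<psi> b - blinfun_apply (\<theta> + \<phi>) b\<bar> < d) \<longrightarrow> P \<psi>"
    using assms by (rule weak_star_nearE)
  show ?thesis
  proof (rule weak_star_nearI[OF B])
    fix \<psi> assume \<psi>: "norm \<psi> \<le> R" "\<And>b. b \<in> B \<Longrightarrow> \<bar>blinfun_apply \<psi> b - blinfun_apply \<phi> b\<bar> < d"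
    have "norm (\<theta> + \<psi>) \<le> R + norm \<theta>" using norm_triangle_ineq[of \<theta> \<psi>] \<psi>(1) by linarith
    then show "P (\<theta> + \<psi>)" using \<psi>(2) by (intro P[rule_format]) (simp_all add: blinfun.add_left)
  qed
qed

text \<open>The members of \<open>H_infty\<close> that are weak* continuous on every ball form a
  norm-closed sublattice containing the evaluations, so \<open>FBL_infty_least\<close>
  applies.\<close>

theorem FBL_infty_weak_star_continuous:
  fixes f :: "('a::banach \<Rightarrow>\<^sub>L real) \<Rightarrow> real"
  assumes "f \<in> FBL_infty" "0 < e"
  shows "weak_star_near R \<phi> (\<lambda>\<psi>. \<bar>f \<psi> - f \<phi>\<bar> < e)"
proof -
  let ?X = "{f \<in> H_infty. \<forall>R \<phi> e. 0 < e \<longrightarrow> weak_star_near R \<phi> (\<lambda>\<psi>. \<bar>f \<psi> - f \<phi>\<bar> < e)}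
    :: (('a \<Rightarrow>\<^sub>L real) \<Rightarrow> real) set"
  note H = sublatticeD[OF H_infty_sublattice]
  have XD: "weak_star_near R \<phi> (\<lambda>\<psi>. \<bar>f \<psi> - f \<phi>\<bar> < e)" if "f \<in> ?X" "0 < e"
    for f :: "('a \<Rightarrow>\<^sub>L real) \<Rightarrow> real" and R \<phi> e
    using that by blast
  have XI: "f \<in> ?X" if "f \<in> H_infty" "\<And>R \<phi> e. 0 < e \<Longrightarrow> weak_star_near R \<phi> (\<lambda>\<psi>. \<bar>f \<psi> - f \<phi>\<bar> < e)"
    for f :: "('a \<Rightarrow>\<^sub>L real) \<Rightarrow> real"
    using that by blast
  have XH: "f \<in> H_infty" if "f \<in> ?X" for f :: "('a \<Rightarrow>\<^sub>L real) \<Rightarrow> real"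
    using that by blast
  have "FBL_infty \<subseteq> ?X"
  proof (rule FBL_infty_least)
    show "function_sublattice ?X"
      unfolding function_sublattice_def
    proof (intro conjI ballI allI)
      show "(\<lambda>_. 0) \<in> ?X"
        by (rule XI[OF H(1)]) (rule weak_star_nearI[of "{}" 1], simp_all)
    next
      fix f g :: "('a \<Rightarrow>\<^sub>L real) \<Rightarrow> real" assume f: "f \<in> ?X" and g: "g \<in> ?X"
      have both: "weak_star_near R \<phi> (\<lambda>\<psi>. \<bar>f \<psi> - f \<phi>\<bar> < e \<and> \<bar>g \<psi> - g \<phi>\<bar> < e)"
        if "0 < e" for R \<phi> e
        using XD[OF f that] XD[OF g that] by (rule weak_star_near_conj)
      have "weak_star_near R \<phi> (\<lambda>\<psi>. \<bar>(f \<psi> + g \<psi>) - (f \<phi> + g \<phi>)\<bar> < e)" if "0 < e" for R \<phi> e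
        by (rule weak_star_near_mono[OF both[of "e / 2"]]) (use that in linarith)+
      then show "(\<lambda>t. f t + g t) \<in> ?X" by (rule XI[OF H(2)[OF XH[OF f] XH[OF g]]])
      have "weak_star_near R \<phi> (\<lambda>\<psi>. \<bar>sup f g \<psi> - sup f g \<phi>\<bar> < e)" if "0 < e" for R \<phi> e
        by (rule weak_star_near_mono[OF both[OF that]]) (auto simp: sup_max)
      then show "sup f g \<in> ?X" by (rule XI[OF H(4)[OF XH[OF f] XH[OF g]]])
      have "weak_star_near R \<phi> (\<lambda>\<psi>. \<bar>inf f g \<psi> - inf f g \<phi>\<bar> < e)" if "0 < e" for R \<phi> e
        by (rule weak_star_near_mono[OF both[OF that]]) (auto simp: inf_min)
      then show "inf f g \<in> ?X" by (rule XI[OF H(5)[OF XH[OF f] XH[OF g]]])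
    next
      fix c :: real and f :: "('a \<Rightarrow>\<^sub>L real) \<Rightarrow> real" assume f: "f \<in> ?X"
      have "weak_star_near R \<phi> (\<lambda>\<psi>. \<bar>c * f \<psi> - c * f \<phi>\<bar> < e)" if e: "0 < e" for R \<phi> e
      proof (rule weak_star_near_mono[OF XD[OF f, of "e / (\<bar>c\<bar> + 1)"]])
        show "0 < e / (\<bar>c\<bar> + 1)" using e by simp
        fix \<psi> assume "\<bar>f \<psi> - f \<phi>\<bar> < e / (\<bar>c\<bar> + 1)"
        then have "(\<bar>c\<bar> + 1) * \<bar>f \<psi> - f \<phi>\<bar> < e" by (simp add: field_simps)
        moreover have "\<bar>c * f \<psi> - c * f \<phi>\<bar> = \<bar>c\<bar> * \<bar>f \<psi> - f \<phi>\<bar>"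
          by (simp add: abs_mult flip: right_diff_distrib)
        ultimately show "\<bar>c * f \<psi> - c * f \<phi>\<bar> < e" by (simp add: distrib_right)
      qed
      then show "(\<lambda>t. c * f t) \<in> ?X" by (rule XI[OF H(3)[OF XH[OF f]]])
    qed
    show "fbl_norm_closed ?X"
      unfolding fbl_norm_closed_def
    proof (intro ballI impI)
      fix f :: "('a \<Rightarrow>\<^sub>L real) \<Rightarrow> real"
      assume f: "f \<in> H_infty" "\<forall>e>0. \<exists>g\<in>?X. fbl_norm (\<lambda>\<phi>. f \<phi> - g \<phi>) < e"
      have "weak_star_near R \<phi> (\<lambda>\<psi>. \<bar>f \<psi> - f \<phi>\<bar> < e)" if e: "0 < e" for R \<phi> e
      proof -
        \<comment> \<open>\<open>M\<close> bounds the norms of both \<open>\<psi>\<close> and the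
          centre \<open>\<phi>\<close>. Homogeneity turns the error \<open>e / (3 * M)\<close> on
          the unit ball into \<open>e / 3\<close> on the ball of radius \<open>M\<close>.\<close>
        define M where "M = \<bar>R\<bar> + norm \<phi> + 1"
        have M: "0 < M" by (simp add: M_def add_nonneg_pos)
        obtain g where g: "g \<in> ?X" "fbl_norm (\<lambda>\<phi>. f \<phi> - g \<phi>) < e / (3 * M)"
          using f(2)[rule_format, of "e / (3 * M)"] e M by auto
        have d: "(\<lambda>\<phi>. f \<phi> - g \<phi>) \<in> H_infty"
          by (rule sublattice_diff[OF H_infty_sublattice f(1) XH[OF g(1)]])
        have close: "\<bar>f \<psi> - g \<psi>\<bar> \<le> e / 3" if "norm \<psi> \<le> M" for \<psi>
        proof -
          have "\<bar>f \<psi> - g \<psi>\<bar> \<le> fbl_norm (\<lambda>\<phi>. f \<phi> - g \<phi>) * norm \<psi>"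
            by (rule abs_le_fbl_norm[OF d])
          also have "\<dots> \<le> e / (3 * M) * M"
            using g(2) that fbl_norm_nonneg[OF d] by (intro mult_mono) auto
          finally show ?thesis using M by simp
        qed
        show ?thesis
        proof (rule weak_star_near_mono[OF XD[OF g(1), of "e / 3"]])
          fix \<psi> assume \<psi>: "norm \<psi> \<le> R" "\<bar>g \<psi> - g \<phi>\<bar> < e / 3"
          have "norm \<psi> \<le> M" using \<psi>(1) norm_ge_zero[of \<phi>] unfolding M_def by linarith
          moreover have "norm \<phi> \<le> M" by (simp add: M_def)
          ultimately show "\<bar>f \<psi> - f \<phi>\<bar> < e" using close[of \<psi>] close[of \<phi>] \<psi>(2) by linarith
        qed (use e in simp)
      qed
      then show "f \<in> ?X" by (rule XI[OF f(1)])
    qed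
    show "range dual_eval \<subseteq> ?X"
    proof (rule image_subsetI)
      fix x :: 'a
      have "weak_star_near R \<phi> (\<lambda>\<psi>. \<bar>dual_eval x \<psi> - dual_eval x \<phi>\<bar> < e)" if "0 < e" for R \<phi> e
        by (rule weak_star_nearI[of "{x}" e]) (use that in \<open>auto simp: dual_eval_def\<close>)
      then show "dual_eval x \<in> ?X" by (rule XI[OF dual_eval_H_infty])
    qed
  qed auto
  then show ?thesis using assms by blast
qed

section \<open>Adjoints of operators bounded below\<close>

lemma adjoint_op_apply: "blinfun_apply (adjoint_op T \<phi>) x = blinfun_apply \<phi> (blinfun_apply T x)"
  by (simp add: adjoint_op_def)

lemma adjoint_op_linear: "linear (adjoint_op T)"
  by (intro linearI blinfun_eqI) (simp_all add: adjoint_op_apply blinfun.add_left blinfun.scaleR_left)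

text \<open>Since \<open>T\<close> is bounded below, \<open>z\<close> is dominated by
  \<open>C * norm z * norm (T x)\<close>, and Hahn--Banach along \<open>T\<close> extends it. The
  norm control keeps liftings of bounded functionals in one ball, where weak* compactness is
  available.\<close>

lemma adjoint_op_lifting:
  fixes T :: "'f::banach \<Rightarrow>\<^sub>L 'e::banach"
  assumes C: "0 < C" "\<And>x. norm x \<le> C * norm (blinfun_apply T x)"
  shows "\<exists>w. adjoint_op T w = z \<and> norm w \<le> C * norm z"
proof -
  have "\<exists>w. norm w \<le> C * norm z \<and> (\<forall>x. blinfun_apply w (blinfun_apply T x) = blinfun_apply z x)"
  proof (rule Hahn_Banach_blinfun)
    show "linear (blinfun_apply T)" "linear (blinfun_apply z)"
      by (simp_all add: bounded_linear.linear blinfun.bounded_linear_right)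
    show "0 \<le> C * norm z" using C(1) by simp
    show "blinfun_apply z x \<le> C * norm z * norm (blinfun_apply T x)" for x
    proof -
      have "blinfun_apply z x \<le> norm z * norm x" using norm_blinfun[of z x] by simp
      also have "\<dots> \<le> norm z * (C * norm (blinfun_apply T x))"
        by (intro mult_left_mono C(2)) simp
      finally show ?thesis by (simp add: mult_ac)
    qed
  qed
  then show ?thesis by (metis adjoint_op_apply blinfun_eqI)
qed

lemma nonzero_blinfun_value:
  fixes \<phi> :: "'a::real_normed_vector \<Rightarrow>\<^sub>L real"
  assumes "\<phi> \<noteq> 0"
  shows "\<exists>x. blinfun_apply \<phi> x = t"
proof -
  obtain x where x: "blinfun_apply \<phi> x \<noteq> 0" using assms by (metis blinfun_eqI zero_blinfun.rep_eq)
  then have "blinfun_apply \<phi> ((t / blinfun_apply \<phi> x) *\<^sub>R x) = t" by (simp add: blinfun.scaleR_right)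
  then show ?thesis by blast
qed

text \<open>The image under \<open>T*\<close> of a superlevel set is open in the bounded weak* topology: a bounded
  functional that is weak* close to 0 on \<open>'f\<close> has, by weak* compactness, a bounded lifting
  that is weak* close to the kernel of \<open>T*\<close>.\<close>

lemma adjoint_op_superlevel_open:
  fixes T :: "'f::banach \<Rightarrow>\<^sub>L 'e::banach"
  assumes C: "0 < C" "\<And>x. norm x \<le> C * norm (blinfun_apply T x)"
    and g: "g \<in> FBL_infty" "c < g y"
  shows "weak_star_near R (adjoint_op T y) (\<lambda>x. \<exists>v. adjoint_op T v = x \<and> c < g v)"
proof -
  \<comment> \<open>\<open>K\<close> bounds a lifting of \<open>x - adjoint_op T y\<close> for
    \<open>norm x \<le> R\<close>. Such a lifting, corrected by another element of the
    \<open>K\<close>-ball and added to \<open>y\<close>, has norm at most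
    \<open>norm y + 2 * K\<close>.\<close>
  define K where "K = C * (R + norm (adjoint_op T y))"
  have "weak_star_near (norm y + 2 * K) y (\<lambda>v. \<bar>g v - g y\<bar> < g y - c)"
    using g by (intro FBL_infty_weak_star_continuous) auto
  then obtain B d where B: "finite B" "0 < d" and near: "\<forall>v. norm v \<le> norm y + 2 * K \<longrightarrow>
      (\<forall>b\<in>B. \<bar>blinfun_apply v b - blinfun_apply y b\<bar> < d) \<longrightarrow> \<bar>g v - g y\<bar> < g y - c"
    by (rule weak_star_nearE)
  \<comment> \<open>\<open>a w\<close> witnesses that \<open>w\<close> is outside the kernel. With
    the value 2, a functional within 1 of \<open>w\<close> at \<open>T (a w)\<close> has value above
    1 there, whereas \<open>x - adjoint_op T y\<close> will be below 1 in absolute value at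
    \<open>a w\<close>.\<close>
  define a where "a w = (SOME x. blinfun_apply (adjoint_op T w) x = 2)" for w
  have a: "blinfun_apply w (blinfun_apply T (a w)) = 2" if "adjoint_op T w \<noteq> 0" for w
    using someI_ex[OF nonzero_blinfun_value[OF that, of 2]]
    unfolding a_def[symmetric] by (simp only: adjoint_op_apply)
  \<comment> \<open>The cover of the \<open>K\<close>-ball has two kinds of neighbourhoods: around
    kernel elements those fine enough for \<open>near\<close>, around other elements those that the
    witness will exclude.\<close>
  define B' where "B' w = (if adjoint_op T w = 0 then B else {blinfun_apply T (a w)})" for w
  define d' where "d' w = (if adjoint_op T w = 0 then d else 1)" for w
  obtain W where W: "finite W" "\<forall>w\<in>W. norm w \<le> K"
    "\<And>w. norm w \<le> K \<Longrightarrow> \<exists>w'\<in>W. \<forall>b\<in>B' w'. \<bar>blinfun_apply w b - blinfun_apply w' b\<bar> < d' w'"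
  proof -
    have "finite (B' w)" "0 < d' w" for w using B by (simp_all add: B'_def d'_def)
    from weak_star_compact_cball[of K B' d', OF this] show ?thesis using that by blast
  qed
  show ?thesis
  proof (rule weak_star_nearI[of "a ` W" 1])
    fix x assume x: "norm x \<le> R"
      "\<And>b. b \<in> a ` W \<Longrightarrow> \<bar>blinfun_apply x b - blinfun_apply (adjoint_op T y) b\<bar> < 1"
    let ?z = "x - adjoint_op T y"
    obtain w where w: "adjoint_op T w = ?z" "norm w \<le> C * norm ?z"
      using adjoint_op_lifting[OF C] by blast
    have "norm ?z \<le> R + norm (adjoint_op T y)"
      using norm_triangle_ineq4[of x "adjoint_op T y"] x(1) by linarith
    then have "C * norm ?z \<le> K" unfolding K_def using C(1) by (intro mult_left_mono) auto
    then have wK: "norm w \<le> K" using w(2) by linarith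
    obtain w' where w': "w' \<in> W"
      "\<forall>b\<in>B' w'. \<bar>blinfun_apply w b - blinfun_apply w' b\<bar> < d' w'"
      using W(3)[OF wK] by blast
    have ker: "adjoint_op T w' = 0"
    proof (rule ccontr)
      assume nz: "adjoint_op T w' \<noteq> 0"
      have "\<bar>blinfun_apply w (blinfun_apply T (a w')) - 2\<bar> < 1"
        using w'(2) nz a[OF nz] by (simp add: B'_def d'_def)
      moreover have "\<bar>blinfun_apply ?z (a w')\<bar> < 1"
        using x(2)[of "a w'"] w'(1) by (simp add: blinfun.diff_left)
      ultimately show False
        using adjoint_op_apply[of T w "a w'"] w(1) by simp
    qed
    \<comment> \<open>Subtracting the kernel element \<open>w'\<close> keeps this a lifting of
      \<open>x\<close>, and \<open>w - w'\<close> is weak* small, so \<open>v\<close> is weak* close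
      to \<open>y\<close>.\<close>
    define v where "v = y + w - w'"
    have "adjoint_op T v = x"
      using ker w(1) by (simp add: v_def linear_add[OF adjoint_op_linear] linear_diff[OF adjoint_op_linear])
    moreover have "\<bar>g v - g y\<bar> < g y - c"
    proof (rule near[rule_format])
      have "norm v \<le> norm (y + w) + norm w'" unfolding v_def by (rule norm_triangle_ineq4)
      then show "norm v \<le> norm y + 2 * K"
        using norm_triangle_ineq[of y w] wK W(2) w'(1) by fastforce
      show "\<bar>blinfun_apply v b - blinfun_apply y b\<bar> < d" if "b \<in> B" for b
        using w'(2) ker that by (simp add: v_def B'_def d'_def blinfun.diff_left blinfun.add_left)
    qed
    ultimately show "\<exists>v. adjoint_op T v = x \<and> c < g v" by (intro exI[of _ v]) auto
  qed (use W(1) in auto)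
qed

text \<open>The Banach--Dieudonne theorem: the increasing finite sets \<open>D n\<close> exhaust the range of a
  null sequence whose polar is contained in \<open>U\<close>.\<close>

theorem Banach_Dieudonne:
  fixes U :: "('a::real_normed_vector \<Rightarrow>\<^sub>L real) set"
  assumes 0: "0 \<in> U" and U: "\<And>R \<phi>. \<phi> \<in> U \<Longrightarrow> weak_star_near R \<phi> (\<lambda>\<psi>. \<psi> \<in> U)"
  shows "\<exists>D :: nat \<Rightarrow> 'a set. (\<forall>n. finite (D n) \<and> D n \<subseteq> D (Suc n) \<and>
      (\<forall>a \<in> D (Suc n) - D n. real n * norm a \<le> 1)) \<and>
    (\<forall>\<phi>. (\<forall>n. \<forall>a\<in>D n. \<bar>blinfun_apply \<phi> a\<bar> \<le> 1) \<longrightarrow> \<phi> \<in> U)"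
proof -
  \<comment> \<open>The invariant \<open>P\<close> says that the polar of the finite set built so
    far lies in \<open>U\<close> within the ball of radius \<open>n\<close>. At \<open>n = 0\<close>
    the norm condition in \<open>Q\<close> is vacuous, so the first new vectors may have any
    length.\<close>
  define P where "P n D \<longleftrightarrow> finite D \<and>
    (\<forall>\<phi>. norm \<phi> \<le> real n \<longrightarrow> (\<forall>a\<in>D. \<bar>blinfun_apply \<phi> a\<bar> \<le> 1) \<longrightarrow> \<phi> \<in> U)" for n and D :: "'a set"
  define Q where "Q n D D' \<longleftrightarrow> D \<subseteq> D' \<and> (\<forall>a \<in> D' - D. real n * norm a \<le> 1)"
    for n and D D' :: "'a set"
  \<comment> \<open>The dual ball of radius \<open>n\<close> is the polar of the ball of radius
    \<open>1 / n\<close>, read as the whole space when \<open>n = 0\<close>.\<close>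
  have large: "\<exists>a. real n * norm a \<le> 1 \<and> 1 < \<bar>blinfun_apply \<phi> a\<bar>"
    if "real n < norm \<phi>" for n and \<phi> :: "'a \<Rightarrow>\<^sub>L real"
  proof (rule ccontr)
    assume neg: "\<not> ?thesis"
    have "\<bar>blinfun_apply \<phi> x\<bar> \<le> real n * norm x" for x
    \<comment> \<open>Scaling by a number \<open>t\<close> strictly above
      \<open>real n * norm x\<close> covers the case where this product is 0.\<close>
    proof (rule dense_ge)
      fix t assume t: "real n * norm x < t"
      then have t0: "0 < t" by (meson le_less_trans mult_nonneg_nonneg norm_ge_zero of_nat_0_le_iff)
      have "real n * norm ((1 / t) *\<^sub>R x) \<le> 1" using t t0 by (simp add: field_simps)
      then have "\<bar>blinfun_apply \<phi> ((1 / t) *\<^sub>R x)\<bar> \<le> 1" using neg by (meson not_le)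
      then show "\<bar>blinfun_apply \<phi> x\<bar> \<le> t" using t0 by (simp add: blinfun.scaleR_right abs_mult field_simps)
    qed
    then have "norm \<phi> \<le> real n" by (intro norm_blinfun_bound) auto
    then show False using that by simp
  qed
  have step: "\<exists>D'. P (Suc n) D' \<and> Q n D D'" if P: "P n D" for n D
  proof -
    define R where "R = real (Suc n)"
    \<comment> \<open>A point of \<open>U\<close> gets a neighbourhood inside \<open>U\<close>. A
      point outside gets a vector \<open>a\<close> with \<open>\<bar>\<phi> a\<bar> > 1\<close>, an
      inequality that persists within \<open>d\<close>. By \<open>P\<close> and
      \<open>large\<close>, this vector can be taken from \<open>D\<close> if
      \<open>norm \<phi> \<le> n\<close>, and short otherwise.\<close>
    define Z where "Z \<phi> B d a \<longleftrightarrow> finite B \<and> 0 < d \<and>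
      (if \<phi> \<in> U then \<forall>\<psi>. norm \<psi> \<le> R \<longrightarrow>
            (\<forall>b\<in>B. \<bar>blinfun_apply \<psi> b - blinfun_apply \<phi> b\<bar> < d) \<longrightarrow> \<psi> \<in> U
       else B = {a} \<and> d = \<bar>blinfun_apply \<phi> a\<bar> - 1 \<and> (a \<in> D \<or> real n * norm a \<le> 1))" for \<phi> B d a
    have "\<exists>B d a. Z \<phi> B d a" for \<phi>
    proof (cases "\<phi> \<in> U")
      case True
      then show ?thesis using U[OF True, of R] unfolding weak_star_near_def Z_def by auto
    next
      case False
      then obtain a where "1 < \<bar>blinfun_apply \<phi> a\<bar>" "a \<in> D \<or> real n * norm a \<le> 1"
        using P large[of n \<phi>] unfolding P_def by (meson not_le)
      then have "Z \<phi> {a} (\<bar>blinfun_apply \<phi> a\<bar> - 1) a" using False by (simp add: Z_def)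
      then show ?thesis by blast
    qed
    then obtain B d a where Z: "\<And>\<phi>. Z \<phi> (B \<phi>) (d \<phi>) (a \<phi>)" by metis
    have Bd: "\<And>\<phi>. finite (B \<phi>)" "\<And>\<phi>. 0 < d \<phi>"
      and in_U: "\<And>\<phi> \<psi>. \<phi> \<in> U \<Longrightarrow> norm \<psi> \<le> R \<Longrightarrow>
        \<forall>b\<in>B \<phi>. \<bar>blinfun_apply \<psi> b - blinfun_apply \<phi> b\<bar> < d \<phi> \<Longrightarrow> \<psi> \<in> U"
      and out_U: "\<And>\<phi>. \<phi> \<notin> U \<Longrightarrow> B \<phi> = {a \<phi>} \<and> d \<phi> = \<bar>blinfun_apply \<phi> (a \<phi>)\<bar> - 1 \<and>
        (a \<phi> \<in> D \<or> real n * norm (a \<phi>) \<le> 1)"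
      using Z unfolding Z_def by (simp_all split: if_splits)
    obtain W where W: "finite W"
      "\<And>\<psi>. norm \<psi> \<le> R \<Longrightarrow> \<exists>\<phi>\<in>W. \<forall>b\<in>B \<phi>. \<bar>blinfun_apply \<psi> b - blinfun_apply \<phi> b\<bar> < d \<phi>"
      using weak_star_compact_cball[of R B d, OF Bd] by blast
    \<comment> \<open>Witnesses that are not short are already in \<open>D\<close>, so finitely many
      short vectors are all that is added.\<close>
    let ?D' = "D \<union> {x \<in> a ` W. real n * norm x \<le> 1}"
    have "\<psi> \<in> U" if \<psi>: "norm \<psi> \<le> R" "\<forall>x\<in>?D'. \<bar>blinfun_apply \<psi> x\<bar> \<le> 1" for \<psi>
    proof -
      obtain \<phi> where \<phi>: "\<phi> \<in> W" "\<forall>b\<in>B \<phi>. \<bar>blinfun_apply \<psi> b - blinfun_apply \<phi> b\<bar> < d \<phi>"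
        using W(2)[OF \<psi>(1)] by blast
      have "\<phi> \<in> U"
      proof (rule ccontr)
        assume "\<phi> \<notin> U"
        note o = out_U[OF this]
        then have "\<bar>blinfun_apply \<psi> (a \<phi>)\<bar> \<le> 1" using \<psi>(2) \<phi>(1) by blast
        moreover have "\<bar>blinfun_apply \<psi> (a \<phi>) - blinfun_apply \<phi> (a \<phi>)\<bar> < \<bar>blinfun_apply \<phi> (a \<phi>)\<bar> - 1"
          using \<phi>(2) o by simp
        ultimately show False by linarith
      qed
      then show ?thesis using in_U \<psi>(1) \<phi>(2) by blast
    qed
    then have "P (Suc n) ?D'" using P W(1) by (auto simp: P_def R_def)
    moreover have "Q n D ?D'" by (auto simp: Q_def)
    ultimately show ?thesis by blast
  qed
  \<comment> \<open>The ball of radius 0 contains only 0, which lies in \<open>U\<close>.\<close>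
  have "P 0 {}" using 0 by (simp add: P_def)
  then obtain D where D: "\<And>n. P n (D n)" "\<And>n. Q n (D n) (D (Suc n))"
    using dependent_nat_choice[of P Q, OF exI step] by blast
  have "\<phi> \<in> U" if "\<forall>n. \<forall>a\<in>D n. \<bar>blinfun_apply \<phi> a\<bar> \<le> 1" for \<phi>
  proof -
    obtain n where "norm \<phi> \<le> real n" using real_arch_simple by blast
    then show ?thesis using D(1)[of n] that unfolding P_def by blast
  qed
  moreover have "\<forall>n. finite (D n) \<and> D n \<subseteq> D (Suc n) \<and> (\<forall>a \<in> D (Suc n) - D n. real n * norm a \<le> 1)"
    using D unfolding P_def Q_def by blast
  ultimately show ?thesis by blast
qed

section \<open>Order continuity\<close>

text \<open>\<open>fbl_norm_closed\<close> speaks only of members of \<open>H_infty\<close>, so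
  homogeneity and boundedness of the limit come first. Homogeneity follows by comparing
  \<open>f\<close> with a homogeneous approximant at both \<open>c *\<^sub>R \<phi>\<close> and
  \<open>\<phi>\<close>.\<close>

lemma FBL_infty_limit:
  assumes "\<And>e. 0 < e \<Longrightarrow> \<exists>g\<in>FBL_infty. \<forall>\<phi>. \<bar>f \<phi> - g \<phi>\<bar> \<le> e * norm \<phi>"
  shows "f \<in> FBL_infty"
proof -
  have "f \<in> H_infty"
  proof -
    have "f (c *\<^sub>R \<phi>) = c * f \<phi>" if c: "0 \<le> c" for c \<phi>
    proof -
      have "\<bar>f (c *\<^sub>R \<phi>) - c * f \<phi>\<bar> \<le> 0 + e" if e: "0 < e" for e
      proof -
        \<comment> \<open>The errors at the two points add up to
          \<open>e / k * (2 * (c * norm \<phi>))\<close>, which is at most \<open>e\<close>; the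
          summand 1 avoids division by 0.\<close>
        define k where "k = 2 * (c * norm \<phi>) + 1"
        have k: "0 < k" unfolding k_def using c by (simp add: add_nonneg_pos)
        obtain g where g: "g \<in> FBL_infty" "\<And>\<phi>. \<bar>f \<phi> - g \<phi>\<bar> \<le> e / k * norm \<phi>"
          using assms[of "e / k"] e k by auto
        have hom: "g (c *\<^sub>R \<phi>) = c * g \<phi>"
          using g(1) c FBL_infty_subset unfolding H_infty_def pos_homogeneous_def by blast
        have "\<bar>f (c *\<^sub>R \<phi>) - c * f \<phi>\<bar> \<le> \<bar>f (c *\<^sub>R \<phi>) - g (c *\<^sub>R \<phi>)\<bar> + \<bar>c * f \<phi> - c * g \<phi>\<bar>"
          unfolding hom by linarith
        also have "\<bar>c * f \<phi> - c * g \<phi>\<bar> = c * \<bar>f \<phi> - g \<phi>\<bar>"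
          using c by (simp add: abs_mult flip: right_diff_distrib)
        also have "\<bar>f (c *\<^sub>R \<phi>) - g (c *\<^sub>R \<phi>)\<bar> + \<dots> \<le> e / k * norm (c *\<^sub>R \<phi>) + c * (e / k * norm \<phi>)"
          by (intro add_mono mult_left_mono g(2) c)
        also have "\<dots> = e / k * (2 * (c * norm \<phi>))" using c by simp
        also have "\<dots> \<le> e / k * k" using e k by (intro mult_left_mono) (auto simp: k_def)
        finally show ?thesis using k by simp
      qed
      then have "\<bar>f (c *\<^sub>R \<phi>) - c * f \<phi>\<bar> \<le> 0" by (rule field_le_epsilon)
      then show ?thesis by simp
    qed
    then have hom: "f \<in> pos_homogeneous" by (simp add: pos_homogeneous_def)
    obtain g where g: "g \<in> FBL_infty" "\<And>\<phi>. \<bar>f \<phi> - g \<phi>\<bar> \<le> 1 * norm \<phi>"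
      using assms[of 1] by auto
    have gH: "g \<in> H_infty" using g(1) FBL_infty_subset by blast
    show ?thesis
    proof (rule H_infty_I[OF hom])
      fix \<phi> :: "'a \<Rightarrow>\<^sub>L real" assume n: "norm \<phi> \<le> 1"
      have "\<bar>g \<phi>\<bar> \<le> fbl_norm g * 1"
        using abs_le_fbl_norm[OF gH, of \<phi>] mult_left_mono[OF n fbl_norm_nonneg[OF gH]] by linarith
      then show "\<bar>f \<phi>\<bar> \<le> fbl_norm g + 1" using g(2)[of \<phi>] n by linarith
    qed
  qed
  moreover have "\<exists>g\<in>FBL_infty. fbl_norm (\<lambda>\<phi>. f \<phi> - g \<phi>) < e" if e: "0 < e" for e
  proof -
    obtain g where g: "g \<in> FBL_infty" "\<And>\<phi>. \<bar>f \<phi> - g \<phi>\<bar> \<le> e / 2 * norm \<phi>"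
      using assms[of "e / 2"] e by auto
    have "fbl_norm (\<lambda>\<phi>. f \<phi> - g \<phi>) \<le> e / 2"
    proof (rule fbl_norm_le)
      fix \<phi> :: "'a \<Rightarrow>\<^sub>L real" assume "norm \<phi> \<le> 1"
      then have "e / 2 * norm \<phi> \<le> e / 2 * 1" using e by (intro mult_left_mono) auto
      then show "\<bar>f \<phi> - g \<phi>\<bar> \<le> e / 2" using g(2)[of \<phi>] by simp
    qed
    then show ?thesis using g(1) e by force
  qed
  ultimately show ?thesis using FBL_infty_closed unfolding fbl_norm_closed_def by blast
qed

lemma FBL_infty_Max:
  assumes "finite A" "A \<noteq> {}" "\<And>a. a \<in> A \<Longrightarrow> F a \<in> FBL_infty"
  shows "(\<lambda>\<phi>. Max ((\<lambda>a. F a \<phi>) ` A)) \<in> FBL_infty"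
  using assms
proof (induction A rule: finite_ne_induct)
  case (singleton x)
  then show ?case by simp
next
  case (insert x A)
  have "(\<lambda>\<phi>. Max ((\<lambda>a. F a \<phi>) ` insert x A)) = sup (F x) (\<lambda>\<phi>. Max ((\<lambda>a. F a \<phi>) ` A))"
    using insert.hyps by (intro ext) (simp add: sup_max)
  moreover have "F x \<in> FBL_infty" "(\<lambda>\<phi>. Max ((\<lambda>a. F a \<phi>) ` A)) \<in> FBL_infty"
    using insert by simp_all
  ultimately show ?case using sublatticeD(4)[OF FBL_infty_sublattice] by metis
qed

lemma FBL_infty_abs_eval: "(\<lambda>\<phi>. \<bar>blinfun_apply \<phi> x\<bar>) \<in> FBL_infty"
proof -
  have "(\<lambda>\<phi>. \<bar>blinfun_apply \<phi> x\<bar>) = sup (dual_eval x) (dual_eval (- x))"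
    by (intro ext) (simp add: dual_eval_def sup_max blinfun.minus_right abs_real_def max_def)
  then show ?thesis
    using sublatticeD(4)[OF FBL_infty_sublattice] dual_eval_FBL_infty by metis
qed

text \<open>The bump is \<open>(\<delta>\<^sub>p - sup\<^sub>a \<bar>\<delta>\<^sub>a - \<theta>(a) \<delta>\<^sub>p\<bar>)\<^sup>+\<close>, with \<open>a\<close> ranging over the
  null sequence given by \<open>D\<close>; this makes the supremum a norm limit of finite ones.\<close>

lemma FBL_infty_bump:
  fixes \<theta> :: "'a::banach \<Rightarrow>\<^sub>L real" and D :: "nat \<Rightarrow> 'a set"
  assumes p: "blinfun_apply \<theta> p = 1"
    and D: "\<And>n. finite (D n)" "\<And>n. D n \<subseteq> D (Suc n)"
      "\<And>n a. a \<in> D (Suc n) - D n \<Longrightarrow> real n * norm a \<le> 1"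
  shows "\<exists>h\<in>FBL_infty. h \<theta> = 1 \<and> (\<forall>\<phi>. 0 < h \<phi> \<longrightarrow> h \<phi> \<le> blinfun_apply \<phi> p \<and>
    (\<forall>n. \<forall>a\<in>D n. \<bar>blinfun_apply \<phi> a - blinfun_apply \<theta> a * blinfun_apply \<phi> p\<bar> \<le> blinfun_apply \<phi> p))"
proof -
  \<comment> \<open>The correction makes \<open>\<theta> (u a) = 0\<close>, so the supremum
    \<open>s\<close> vanishes at \<open>\<theta>\<close> and the bump has the value
    \<open>\<theta> p = 1\<close> there.\<close>
  define u where "u a = a - blinfun_apply \<theta> a *\<^sub>R p" for a
  \<comment> \<open>Inserting 0 makes the index sets nonempty; as \<open>u 0 = 0\<close>, it
    contributes the value 0.\<close>
  define A where "A = insert 0 (\<Union>n. D n)"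
  define s where "s \<phi> = (SUP a\<in>A. \<bar>blinfun_apply \<phi> (u a)\<bar>)" for \<phi> :: "'a \<Rightarrow>\<^sub>L real"
  define s' where "s' n \<phi> = Max ((\<lambda>a. \<bar>blinfun_apply \<phi> (u a)\<bar>) ` insert 0 (D n))"
    for n and \<phi> :: "'a \<Rightarrow>\<^sub>L real"
  define k where "k = 1 + norm \<theta> * norm p"
  have k: "0 < k" by (simp add: k_def add_pos_nonneg)
  have mono: "D m \<subseteq> D n" if "m \<le> n" for m n
    using D(2) that by (rule lift_Suc_mono_le)
  \<comment> \<open>A nonzero vector of \<open>A\<close> outside \<open>D n\<close> enters at some
    stage from \<open>n\<close> on, where \<open>D\<close> admits only vectors of norm at most
    \<open>1 / n\<close> if \<open>n > 0\<close>; the induction locates that stage.\<close>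
  have tail: "real n * norm a \<le> 1" if "a \<in> A" "a \<notin> D n" for a n
  proof (cases "a = 0")
    case False
    then obtain m where m: "a \<in> D m" using \<open>a \<in> A\<close> unfolding A_def by blast
    have "a \<in> D (n + j) \<longrightarrow> real n * norm a \<le> 1" for j
    proof (induction j)
      case 0
      then show ?case using that(2) by simp
    next
      case (Suc j)
      show ?case
      proof (cases "a \<in> D (n + j)")
        case False
        have "real n * norm a \<le> real (n + j) * norm a" by (intro mult_right_mono) auto
        then show ?thesis using D(3)[of a "n + j"] False by auto
      qed (use Suc in simp)
    qed
    then show ?thesis using mono[of m "n + m"] m by auto
  qed simp
  have nu: "norm (u a) \<le> k * norm a" for a
  proof -
    have "norm (u a) \<le> norm a + \<bar>blinfun_apply \<theta> a\<bar> * norm p"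
      unfolding u_def using norm_triangle_ineq4[of a "blinfun_apply \<theta> a *\<^sub>R p"] by simp
    also have "\<bar>blinfun_apply \<theta> a\<bar> * norm p \<le> (norm \<theta> * norm a) * norm p"
      using norm_blinfun[of \<theta> a] by (intro mult_right_mono) auto
    finally show ?thesis by (simp add: k_def algebra_simps)
  qed
  have tail_le: "\<bar>blinfun_apply \<phi> (u a)\<bar> \<le> k / real n * norm \<phi>"
    if "a \<in> A" "a \<notin> D n" "0 < n" for \<phi> :: "'a \<Rightarrow>\<^sub>L real" and a n
  proof -
    have "norm a \<le> 1 / real n" using tail[OF that(1,2)] that(3) by (simp add: field_simps)
    then have "norm (u a) \<le> k * (1 / real n)"
      using nu[of a] k mult_left_mono[of "norm a" "1 / real n" k] by linarith
    then have "norm \<phi> * norm (u a) \<le> norm \<phi> * (k * (1 / real n))" by (intro mult_left_mono) auto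
    then show ?thesis using norm_blinfun[of \<phi> "u a"] by (simp add: mult_ac)
  qed
  have s'_ge: "\<bar>blinfun_apply \<phi> (u a)\<bar> \<le> s' n \<phi>" if "a \<in> insert 0 (D n)" for \<phi> a n
    unfolding s'_def using D(1)[of n] that by (intro Max_ge) auto
  have s'_nonneg: "0 \<le> s' n \<phi>" for n \<phi>
    by (rule order_trans[OF abs_ge_zero s'_ge[OF insertI1]])
  have term_le: "\<bar>blinfun_apply \<phi> (u a)\<bar> \<le> s' n \<phi> + k / real n * norm \<phi>"
    if "a \<in> A" "0 < n" for \<phi> a n
  proof (cases "a \<in> D n")
    case True
    have "0 \<le> k / real n * norm \<phi>" using k by simp
    then show ?thesis using s'_ge[of a n \<phi>] True by simp
  next
    case False
    then show ?thesis using tail_le[OF that(1) False that(2), of \<phi>] s'_nonneg[of n \<phi>] by linarith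
  qed
  have bdd: "bdd_above ((\<lambda>a. \<bar>blinfun_apply \<phi> (u a)\<bar>) ` A)" for \<phi> :: "'a \<Rightarrow>\<^sub>L real"
    by (rule bdd_aboveI2[where M = "s' 1 \<phi> + k / real 1 * norm \<phi>"]) (simp only: term_le zero_less_one)
  have s_ge: "\<bar>blinfun_apply \<phi> (u a)\<bar> \<le> s \<phi>" if "a \<in> A" for \<phi> a
    unfolding s_def using bdd that by (intro cSUP_upper)
  have s'_le_s: "s' n \<phi> \<le> s \<phi>" for n \<phi>
    unfolding s'_def using D(1)[of n] s_ge by (intro Max.boundedI) (auto simp: A_def)
  have s_le_s': "s \<phi> \<le> s' n \<phi> + k / real n * norm \<phi>" if "0 < n" for n \<phi>
    unfolding s_def using term_le[OF _ that] by (intro cSUP_least) (auto simp: A_def)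
  have s'_FBL: "s' n \<in> FBL_infty" for n
    unfolding s'_def using D(1)[of n] by (intro FBL_infty_Max FBL_infty_abs_eval) auto
  define h where "h \<phi> = max 0 (blinfun_apply \<phi> p - s \<phi>)" for \<phi>
  have "h \<in> FBL_infty"
  proof (rule FBL_infty_limit)
    fix e :: real assume e: "0 < e"
    \<comment> \<open>The finite maxima \<open>s' n\<close> differ from \<open>s\<close> by at most
      \<open>k / n * norm \<phi>\<close>, so this \<open>n\<close> brings the error below
      \<open>e * norm \<phi>\<close>.\<close>
    obtain n where "k / e < real n" using reals_Archimedean2 by blast
    then have kn: "k < e * real n" using e by (simp add: field_simps)
    then have "0 < n" using k by (cases n) auto
    then have n: "0 < n" "k / real n < e" using kn by (simp_all add: field_simps)
    have "(\<lambda>\<phi>. dual_eval p \<phi> - s' n \<phi>) \<in> FBL_infty"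
      by (intro sublattice_diff[OF FBL_infty_sublattice] dual_eval_FBL_infty s'_FBL)
    then have "sup (\<lambda>_. 0) (\<lambda>\<phi>. dual_eval p \<phi> - s' n \<phi>) \<in> FBL_infty"
      using sublatticeD(1,4)[OF FBL_infty_sublattice] by blast
    moreover have "\<bar>h \<phi> - sup (\<lambda>_. 0) (\<lambda>\<phi>. dual_eval p \<phi> - s' n \<phi>) \<phi>\<bar> \<le> e * norm \<phi>" for \<phi>
    proof -
      have "k / real n * norm \<phi> \<le> e * norm \<phi>" using n(2) by (intro mult_right_mono) auto
      then have "\<bar>s \<phi> - s' n \<phi>\<bar> \<le> e * norm \<phi>"
        using s'_le_s[of n \<phi>] s_le_s'[OF n(1), of \<phi>] by linarith
      then show ?thesis by (simp add: h_def dual_eval_def sup_max)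
    qed
    ultimately show "\<exists>g\<in>FBL_infty. \<forall>\<phi>. \<bar>h \<phi> - g \<phi>\<bar> \<le> e * norm \<phi>" by blast
  qed
  moreover have "h \<theta> = 1"
  proof -
    have "\<bar>blinfun_apply \<theta> (u a)\<bar> = 0" for a
      by (simp add: u_def blinfun.diff_right blinfun.scaleR_right p)
    moreover have "A \<noteq> {}" by (simp add: A_def)
    ultimately have "s \<theta> = 0" unfolding s_def by simp
    then show ?thesis by (simp add: h_def p)
  qed
  moreover have "h \<phi> \<le> blinfun_apply \<phi> p \<and>
      (\<forall>n. \<forall>a\<in>D n. \<bar>blinfun_apply \<phi> a - blinfun_apply \<theta> a * blinfun_apply \<phi> p\<bar> \<le> blinfun_apply \<phi> p)"
    if "0 < h \<phi>" for \<phi>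
  proof -
    have pos: "h \<phi> = blinfun_apply \<phi> p - s \<phi>" "s \<phi> \<le> blinfun_apply \<phi> p"
      using that unfolding h_def by linarith+
    have "0 \<le> s \<phi>" using s_ge[of 0 \<phi>] by (simp add: A_def)
    moreover have "\<bar>blinfun_apply \<phi> a - blinfun_apply \<theta> a * blinfun_apply \<phi> p\<bar> \<le> blinfun_apply \<phi> p"
      if "a \<in> D n" for a n
    proof -
      have "a \<in> A" using that by (auto simp: A_def)
      then show ?thesis
        using s_ge[of a \<phi>] pos(2) by (simp add: u_def blinfun.diff_right blinfun.scaleR_right)
    qed
    ultimately show ?thesis using pos(1) by auto
  qed
  ultimately show ?thesis by (intro bexI[of _ h]) simp_all
qed

theorem order_continuous_free_hom:
  fixes T :: "'f::banach \<Rightarrow>\<^sub>L 'e::banach"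
  assumes inj: "inj (blinfun_apply T)" and closed: "closed (range (blinfun_apply T))"
  shows "order_continuous_on FBL_infty FBL_infty (free_hom T)"
  unfolding order_continuous_on_def
proof (intro allI impI)
  fix I :: "(('f \<Rightarrow>\<^sub>L real) \<Rightarrow> real) set" and le
    and f :: "(('f \<Rightarrow>\<^sub>L real) \<Rightarrow> real) \<Rightarrow> ('f \<Rightarrow>\<^sub>L real) \<Rightarrow> real"
  assume I: "directed_index I le" and f: "decreases_to_zero FBL_infty I le f"
  obtain C where C: "0 < C" "\<And>x. norm x \<le> C * norm (blinfun_apply T x)"
    using bounded_below_of_closed_range[OF inj closed] by blast
  have fF: "f i \<in> FBL_infty" and f0: "0 \<le> f i \<phi>" if "i \<in> I" for i \<phi>
    using f that unfolding decreases_to_zero_def by (auto simp: le_fun_def)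
  have inf: "h \<le> (\<lambda>_. 0)" if "h \<in> FBL_infty" "\<And>i. i \<in> I \<Longrightarrow> h \<le> f i" for h
    using f that unfolding decreases_to_zero_def by blast
  have "g y \<le> 0" if g: "g \<in> FBL_infty" "\<And>i. i \<in> I \<Longrightarrow> g \<le> free_hom T (f i)" for g y
  proof (rule ccontr)
    assume "\<not> g y \<le> 0"
    define c where "c = g y / 2"
    have c: "0 < c" "c < g y" using \<open>\<not> g y \<le> 0\<close> by (simp_all add: c_def)
    define \<theta> where "\<theta> = adjoint_op T y"
    \<comment> \<open>Translating by \<open>\<theta>\<close> places the open set around 0, as
      \<open>Banach_Dieudonne\<close> requires.\<close>
    define U where "U = {z. \<exists>v. adjoint_op T v = \<theta> + z \<and> c < g v}"
    have U: "weak_star_near R z (\<lambda>x. x \<in> U)" if z: "z \<in> U" for R z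
    proof -
      obtain v where v: "adjoint_op T v = \<theta> + z" "c < g v" using z unfolding U_def by blast
      have "weak_star_near (R + norm \<theta>) (\<theta> + z) (\<lambda>x. \<exists>v. adjoint_op T v = x \<and> c < g v)"
        unfolding v(1)[symmetric] using C g(1) v(2) by (rule adjoint_op_superlevel_open)
      then show ?thesis
        unfolding U_def mem_Collect_eq by (rule weak_star_near_translate)
    qed
    have "0 \<in> U" using c(2) by (auto simp: U_def \<theta>_def)
    from Banach_Dieudonne[OF this U] obtain D :: "nat \<Rightarrow> 'f set" where
      D0: "\<forall>n. finite (D n) \<and> D n \<subseteq> D (Suc n) \<and> (\<forall>a \<in> D (Suc n) - D n. real n * norm a \<le> 1)"
        "\<forall>\<phi>. (\<forall>n. \<forall>a\<in>D n. \<bar>blinfun_apply \<phi> a\<bar> \<le> 1) \<longrightarrow> \<phi> \<in> U"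
      by blast
    then have D: "\<And>n. finite (D n)" "\<And>n. D n \<subseteq> D (Suc n)"
        "\<And>n a. a \<in> D (Suc n) - D n \<Longrightarrow> real n * norm a \<le> 1"
      by blast+
    have DU: "\<phi> \<in> U" if "\<And>n a. a \<in> D n \<Longrightarrow> \<bar>blinfun_apply \<phi> a\<bar> \<le> 1" for \<phi>
      using D0(2) that by blast
    \<comment> \<open>All \<open>f i\<close> vanish at 0, whereas
      \<open>f i \<theta> \<ge> g y > 0\<close>; the net is nonempty, so some \<open>i\<close>
      exists.\<close>
    have "\<theta> \<noteq> 0"
    proof
      assume \<theta>: "\<theta> = 0"
      obtain i where i: "i \<in> I" using I unfolding directed_index_def by blast
      have "f i 0 = 0" using abs_le_fbl_norm[of "f i" 0] fF[OF i] FBL_infty_subset by auto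
      then show False
        using g(2)[OF i, THEN le_funD, of y] c \<theta> by (simp add: free_hom_def \<theta>_def)
    qed
    then obtain p where p: "blinfun_apply \<theta> p = 1" using nonzero_blinfun_value by blast
    obtain h where h: "h \<in> FBL_infty" "h \<theta> = 1"
      and "\<forall>\<phi>. 0 < h \<phi> \<longrightarrow> h \<phi> \<le> blinfun_apply \<phi> p \<and>
        (\<forall>n. \<forall>a\<in>D n. \<bar>blinfun_apply \<phi> a - blinfun_apply \<theta> a * blinfun_apply \<phi> p\<bar> \<le> blinfun_apply \<phi> p)"
      using FBL_infty_bump[of \<theta> p D, OF p D] by blast
    then have hp: "\<And>\<phi>. 0 < h \<phi> \<Longrightarrow> h \<phi> \<le> blinfun_apply \<phi> p"
        "\<And>\<phi> n a. 0 < h \<phi> \<Longrightarrow> a \<in> D n \<Longrightarrow>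
          \<bar>blinfun_apply \<phi> a - blinfun_apply \<theta> a * blinfun_apply \<phi> p\<bar> \<le> blinfun_apply \<phi> p"
      by blast+
    have "c * h \<phi> \<le> f i \<phi>" if i: "i \<in> I" for i \<phi>
    proof (cases "0 < h \<phi>")
      case False
      then have "c * h \<phi> \<le> 0" using c(1) by (simp add: mult_nonneg_nonpos)
      then show ?thesis using f0[OF i, of \<phi>] by linarith
    next
      case True
      \<comment> \<open>Dividing by \<open>t\<close> normalizes \<open>\<phi>\<close> to the value 1
        at \<open>p\<close>. The bump's inequalities then say that
        \<open>\<phi> / t - \<theta>\<close> is at most 1 in absolute value on every
        \<open>D n\<close>, so it lies in \<open>U\<close>.\<close>
      define t where "t = blinfun_apply \<phi> p"
      have t: "0 < t" "h \<phi> \<le> t" using True hp(1)[OF True] by (simp_all add: t_def)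
      have "(1 / t) *\<^sub>R \<phi> - \<theta> \<in> U"
      proof (rule DU)
        fix n a assume "a \<in> D n"
        then have "\<bar>blinfun_apply \<phi> a - blinfun_apply \<theta> a * t\<bar> / t \<le> 1"
          using hp(2)[OF True] t(1) by (simp add: t_def)
        moreover have "blinfun_apply ((1 / t) *\<^sub>R \<phi> - \<theta>) a = (blinfun_apply \<phi> a - blinfun_apply \<theta> a * t) / t"
          using t(1) by (simp add: blinfun.diff_left blinfun.scaleR_left diff_divide_distrib)
        ultimately show "\<bar>blinfun_apply ((1 / t) *\<^sub>R \<phi> - \<theta>) a\<bar> \<le> 1"
          using t(1) by (simp add: abs_divide)
      qed
      then obtain v where v: "adjoint_op T v = (1 / t) *\<^sub>R \<phi>" "c < g v" by (auto simp: U_def)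
      have "c \<le> f i ((1 / t) *\<^sub>R \<phi>)"
        using g(2)[OF i, THEN le_funD, of v] v by (simp add: free_hom_def)
      also have "\<dots> = (1 / t) * f i \<phi>"
        using fF[OF i] FBL_infty_subset t(1) unfolding H_infty_def pos_homogeneous_def by auto
      finally have "c * t \<le> f i \<phi>" using t(1) by (simp add: field_simps)
      moreover have "c * h \<phi> \<le> c * t" using c(1) t(2) by (intro mult_left_mono) auto
      ultimately show ?thesis by linarith
    qed
    then have "(\<lambda>\<phi>. c * h \<phi>) \<le> (\<lambda>_. 0)"
      using inf[OF sublatticeD(3)[OF FBL_infty_sublattice h(1)]] by (auto simp: le_fun_def)
    then have "c * h \<theta> \<le> 0" by (rule le_funD)
    then show False using h(2) c(1) by simp
  qed
  moreover have "(\<lambda>i. free_hom T (f i)) \<in> I \<rightarrow> FBL_infty"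
    using fF free_hom_FBL_infty by blast
  moreover have "monotone_on I le (\<ge>) (\<lambda>i. free_hom T (f i))"
    using f unfolding decreases_to_zero_def monotone_on_def free_hom_def by (auto simp: le_fun_def)
  ultimately show "decreases_to_zero FBL_infty I le (\<lambda>i. free_hom T (f i))"
    using f0 unfolding decreases_to_zero_def by (auto simp: le_fun_def free_hom_def)
qed

theorem inj_of_order_continuous_free_hom:
  fixes T :: "'f::banach \<Rightarrow>\<^sub>L 'e::banach"
  assumes "T \<noteq> 0" and oc: "order_continuous_on FBL_infty FBL_infty (free_hom T)"
  shows "inj (blinfun_apply T)"
proof (rule ccontr)
  assume "\<not> inj (blinfun_apply T)"
  then obtain a b where "a \<noteq> b" "blinfun_apply T a = blinfun_apply T b" unfolding inj_def by blast
  then obtain p where p: "p \<noteq> 0" "blinfun_apply T p = 0"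
    by (metis blinfun.diff_right right_minus_eq)
  \<comment> \<open>Such a \<open>q\<close> exists because \<open>T \<noteq> 0\<close>. If
    \<open>T q\<close> were 0, the images of the \<open>f n\<close> below would all be 0 and there
    would be no contradiction.\<close>
  obtain q where q: "blinfun_apply T q \<noteq> 0" using assms(1) by (metis blinfun_eqI zero_blinfun.rep_eq)
  obtain \<theta> :: "'f \<Rightarrow>\<^sub>L real" where \<theta>: "blinfun_apply \<theta> p = 1" using separating_functional[OF p(1)] by blast
  obtain y :: "'e \<Rightarrow>\<^sub>L real" where y: "blinfun_apply y (blinfun_apply T q) = 1"
    using separating_functional[OF q] by blast
  define f where "f n \<phi> = max 0 (\<bar>blinfun_apply \<phi> q\<bar> - real n * \<bar>blinfun_apply \<phi> p\<bar>)"
    for n and \<phi> :: "'f \<Rightarrow>\<^sub>L real"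
  have I: "directed_index UNIV ((\<le>) :: nat \<Rightarrow> nat \<Rightarrow> bool)"
    by (auto simp: directed_index_def reflp_on_def transp_on_def intro: max.cobounded1 max.cobounded2)
  have fF: "f n \<in> FBL_infty" for n
  proof -
    have "(\<lambda>\<phi>. \<bar>blinfun_apply \<phi> q\<bar> - real n * \<bar>blinfun_apply \<phi> p\<bar>) \<in> FBL_infty"
      by (intro sublattice_diff[OF FBL_infty_sublattice] sublatticeD(3)[OF FBL_infty_sublattice]
          FBL_infty_abs_eval)
    then have "sup (\<lambda>_. 0) (\<lambda>\<phi>. \<bar>blinfun_apply \<phi> q\<bar> - real n * \<bar>blinfun_apply \<phi> p\<bar>) \<in> FBL_infty"
      using sublatticeD(1,4)[OF FBL_infty_sublattice] by blast
    moreover have "f n = sup (\<lambda>_. 0) (\<lambda>\<phi>. \<bar>blinfun_apply \<phi> q\<bar> - real n * \<bar>blinfun_apply \<phi> p\<bar>)"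
      by (auto simp: f_def sup_max)
    ultimately show ?thesis by simp
  qed
  have "decreases_to_zero FBL_infty UNIV (\<le>) f"
    unfolding decreases_to_zero_def
  proof (intro conjI ballI impI)
    show "f \<in> UNIV \<rightarrow> FBL_infty" using fF by blast
    have "f n \<phi> \<le> f m \<phi>" if "m \<le> n" for m n \<phi>
    proof -
      have "real m * \<bar>blinfun_apply \<phi> p\<bar> \<le> real n * \<bar>blinfun_apply \<phi> p\<bar>"
        using that by (intro mult_right_mono) auto
      then show ?thesis unfolding f_def by linarith
    qed
    then show "monotone_on UNIV (\<le>) (\<ge>) f" by (auto simp: monotone_on_def le_fun_def)
    show "(\<lambda>_. 0) \<le> f n" for n by (simp add: f_def le_fun_def)
  next
    fix g assume g: "g \<in> FBL_infty" "\<forall>n\<in>UNIV. g \<le> f n"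
    have off: "g \<phi> \<le> 0" if \<phi>: "blinfun_apply \<phi> p \<noteq> 0" for \<phi>
    proof -
      obtain n where "\<bar>blinfun_apply \<phi> q\<bar> < real n * \<bar>blinfun_apply \<phi> p\<bar>"
        using ex_less_of_nat_mult[of "\<bar>blinfun_apply \<phi> p\<bar>"] \<phi> by auto
      then have "f n \<phi> = 0" by (simp add: f_def)
      moreover have "g \<phi> \<le> f n \<phi>" using g(2) by (auto simp: le_fun_def)
      ultimately show ?thesis by simp
    qed
    \<comment> \<open>On the hyperplane, \<open>\<phi>\<close> is approached by
      \<open>\<phi> + t *\<^sub>R \<theta>\<close>, which is off it since
      \<open>\<theta> p = 1\<close>; weak* continuity on a ball carries the bound over.\<close>
    have "g \<phi> \<le> 0" for \<phi>
    proof (rule ccontr)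
      assume neg: "\<not> g \<phi> \<le> 0"
      then have on: "blinfun_apply \<phi> p = 0" using off by blast
      have "weak_star_near (norm \<phi> + norm \<theta>) \<phi> (\<lambda>\<psi>. \<bar>g \<psi> - g \<phi>\<bar> < g \<phi>)"
        using neg by (intro FBL_infty_weak_star_continuous[OF g(1)]) simp
      then obtain B d where B: "finite B" "0 < d" and near: "\<forall>\<psi>. norm \<psi> \<le> norm \<phi> + norm \<theta> \<longrightarrow>
          (\<forall>b\<in>B. \<bar>blinfun_apply \<psi> b - blinfun_apply \<phi> b\<bar> < d) \<longrightarrow> \<bar>g \<psi> - g \<phi>\<bar> < g \<phi>"
        by (rule weak_star_nearE)
      define M where "M = (\<Sum>b\<in>B. \<bar>blinfun_apply \<theta> b\<bar>) + 1"
      have M: "0 < M" by (simp add: M_def add_nonneg_pos sum_nonneg)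
      have less_M: "\<bar>blinfun_apply \<theta> b\<bar> < M" if "b \<in> B" for b
        using member_le_sum[OF that, of "\<lambda>b. \<bar>blinfun_apply \<theta> b\<bar>"] B(1) by (simp add: M_def)
      \<comment> \<open>The bound 1 keeps the perturbed functional in the ball, and
        \<open>d / M\<close> keeps it within \<open>d\<close> on \<open>B\<close>, as
        \<open>M\<close> strictly exceeds every \<open>\<bar>\<theta> b\<bar>\<close>.\<close>
      define t where "t = min 1 (d / M)"
      have t: "0 < t" "t \<le> 1" "t * M \<le> d" using B(2) M by (auto simp: t_def min_def field_simps)
      have "\<bar>g (\<phi> + t *\<^sub>R \<theta>) - g \<phi>\<bar> < g \<phi>"
      proof (rule near[rule_format])
        have "norm (t *\<^sub>R \<theta>) \<le> norm \<theta>" using t mult_right_mono[of t 1 "norm \<theta>"] by simp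
        then show "norm (\<phi> + t *\<^sub>R \<theta>) \<le> norm \<phi> + norm \<theta>"
          using norm_triangle_ineq[of \<phi> "t *\<^sub>R \<theta>"] by linarith
        show "\<bar>blinfun_apply (\<phi> + t *\<^sub>R \<theta>) b - blinfun_apply \<phi> b\<bar> < d" if "b \<in> B" for b
          using less_le_trans[OF mult_strict_left_mono[OF less_M[OF that] t(1)] t(3)] t(1)
          by (simp add: blinfun.add_left blinfun.scaleR_left abs_mult)
      qed
      moreover have "g (\<phi> + t *\<^sub>R \<theta>) \<le> 0"
        using on \<theta> t(1) by (intro off) (simp add: blinfun.add_left blinfun.scaleR_left)
      ultimately show False by linarith
    qed
    then show "g \<le> (\<lambda>_. 0)" by (simp add: le_fun_def)
  qed
  \<comment> \<open>The definition of order continuity uses nets indexed by sets of functions;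
    \<open>order_continuous_on_net\<close> transfers it to this sequence.\<close>
  then have lim: "decreases_to_zero FBL_infty UNIV (\<le>) (\<lambda>n. free_hom T (f n))"
    by (rule order_continuous_on_net[OF oc I])
  define g where "g = (\<lambda>\<phi> :: 'e \<Rightarrow>\<^sub>L real. \<bar>blinfun_apply \<phi> (blinfun_apply T q)\<bar>)"
  have "g \<le> free_hom T (f n)" for n
    by (simp add: le_fun_def g_def free_hom_def f_def adjoint_op_apply p(2))
  then have "g \<le> (\<lambda>_. 0)"
    using lim FBL_infty_abs_eval unfolding decreases_to_zero_def g_def by blast
  then have "g y \<le> 0" by (rule le_funD)
  then show False using y by (simp add: g_def)
qed

text \<open>The second implication excludes \<open>T = 0\<close>: by
  \<open>order_continuous_free_hom_zero\<close> the zero operator always induces an order continuous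
  map, yet it is not injective on a nonzero space.\<close>

theorem theorem11:
  fixes T :: "'f::banach \<Rightarrow>\<^sub>L 'e::banach"
  shows "(inj (blinfun_apply T) \<and> closed (range (blinfun_apply T)) \<longrightarrow>
            order_continuous_on FBL_infty FBL_infty (free_hom T)) \<and>
         (T \<noteq> 0 \<and> order_continuous_on FBL_infty FBL_infty (free_hom T) \<longrightarrow>
            inj (blinfun_apply T))"
  using order_continuous_free_hom inj_of_order_continuous_free_hom by blast

end
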